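(* Suppose $\lim_{\eta\uparrow\infty}\epsilon_\eta\tau_\eta=0$ and $\lambda^\star_\eta=\lambda^\star$ for all $\eta>0$, where $\lambda^\star=\mu^\star$. Suppose the following conditions hold. (Negative Drift) There exist $\delta,K,B>0$ such that $\phi^c(x)-\phi^s(x)<-\delta$ and $[\phi^c(x)]^++[\phi^s(x)]^-\le B$ for all $x>K$, and $\phi^c(x)-\phi^s(x)>\delta$ and $[\phi^c(x)]^-+[\phi^s(x)]^+\le B$ for all $x<-K$. (sub-Quadratic Growth) There exists $\beta\in(0,2)$ such that $|\phi^c(x)|\le|x|^\beta$ and $|\phi^s(x)|\le|x|^\beta$ for all $x\in\mathbb{R}$. (Finite Limits) The limits $\phi^i(\infty)=\lim_{x\to\infty}\phi^i(x)$ and $\phi^i(-\infty)=\lim_{x\to-\infty}\phi^i(x)$ exist and are finite for $i\in\{c,s\}$. ($\pm$ Jumps) With $K$ as in the Negative Drift condition, there exists $p_{\min}>0$ such that for all $\eta>0$ and all $z\in\mathbb{Z}$ with $|z|\le K\max\{\tau_\eta,1/\epsilon_\eta\}$: $P(a^c_\eta(z)>a^s_\eta(z))\ge p_{\min}$ and $P(a^c_\eta(z)<a^s_\eta(z))\ge p_{\min}$. Let $\eta_p>0$ be such that the imbalance DTMC $\{z_\eta(k):k\in\mathbb{Z}_+\}$ is positive recurrent for every $\eta>\eta_p$, and let $\bar z_\eta$ denote its steady-state random variable. Define $\chi(x)=\phi^s(\infty)-\phi^c(\infty)$ for $x\ge0$ and $\chi(x)=\phi^s(-\infty)-\phi^c(-\infty)$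 for $x<0$. Then, as $\eta\uparrow\infty$, $$\epsilon_\eta\bar z_\eta\overset{D}{\longrightarrow}\operatorname{Laplace}\left(0,\ \frac{2\sqrt{|\chi(1)\chi(-1)|}}{\sigma^c(\lambda^\star)+\sigma^s(\mu^\star)},\ \sqrt{\frac{|\chi(1)|}{|\chi(-1)|}}\right).$$
   Context: Notation: $\mathbb{Z}_+$ is the set of non-negative integers; $[x]^+=\max\{x,0\}$, $[x]^-=\max\{-x,0\}$; $\operatorname{clip}(x,x_{\max},x_{\min})=\max\{\min\{x,x_{\max}\},x_{\min}\}$; $\overset{D}{\to}$ is convergence in distribution. Model (matching queue). Fix constants $\lambda_{\max}\ge\lambda_{\min}\ge0$, $\mu_{\max}\ge\mu_{\min}\ge0$, $\sigma_{\max}>0$, $M>0$ and $\mu^\star$ with $\lambda_{\min}<\mu^\star<\lambda_{\max}$ and $\mu_{\min}<\mu^\star<\mu_{\max}$; continuous functions $\sigma^c,\sigma^s:\mathbb{R}\to[0,\sigma_{\max}]$; and Borel measurable control curves $\phi^c,\phi^s:\mathbb{R}\to\mathbb{R}$. For each $\eta>0$ let $\epsilon_\eta>0$, $\tau_\eta>0$, $\lambda^\star_\eta\in\mathbb{R}$, and for $z\in\mathbb{Z}$ put $$\lambda_\eta(z)=\operatorname{clip}\!\left(\lambda^\star_\eta+\epsilon_\eta\phi^c(z/\tau_\eta),\lambda_{\max},\lambda_{\min}\right),\quad \mu_\eta(z)=\operatorname{clip}\!\left(\mu^\star+\epsilon_\eta\phi^s(z/\tau_\eta),\mu_{\max},\mu_{\min}\right).$$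 For each $\eta>0$ the random variables $a^c_\eta(z,k),a^s_\eta(z,k)$ ($z\in\mathbb{Z},k\in\mathbb{Z}_+$) are $\mathbb{Z}_+$-valued and mutually independent; for each $z$, the $a^c_\eta(z,k)$, $k\in\mathbb{Z}_+$, are identically distributed with generic copy $a^c_\eta(z)$, and similarly for $a^s_\eta(z)$. They satisfy $E[a^c_\eta(z)]=\lambda_\eta(z)$, $E[a^s_\eta(z)]=\mu_\eta(z)$, $\operatorname{Var}[a^c_\eta(z)]=\sigma^c(\lambda_\eta(z))$, $\operatorname{Var}[a^s_\eta(z)]=\sigma^s(\mu_\eta(z))$, $E[|a^c_\eta(z)|^3]\le M$, $E[|a^s_\eta(z)|^3]\le M$. The imbalance is the DTMC on $\mathbb{Z}$ with $z_\eta(0)=0$ and $z_\eta(k+1)=z_\eta(k)+a^c_\eta(z_\eta(k),k)-a^s_\eta(z_\eta(k),k)$. The arrival distributions are assumed such that this DTMC is irreducible on $\mathbb{Z}$ and aperiodic. When it is positive recurrent, $\bar z_\eta$ is a random variable with its unique stationary distribution. Asymptotic regime: as $\eta\uparrow\infty$, $\epsilon_\eta\to0$ and/or $\tau_\eta\to\infty$ (at least one holds). $\operatorname{Laplace}(m,\lambda,\kappa)$, for $m\in\mathbb{R}$, $\lambda>0$, $\kappa>0$, is the distribution with density $\frac{\lambda}{\kappa+1/\kappa}e^{\frac{\lambda}{\kappa}(x-m)}$ for $x<m$ and $\frac{\lambda}{\kappa+1/\kappa}e^{-\lambda\kappa(x-m)}$ for $x\ge m$. *)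

theory Defs
  imports "HOL-Probability.Probability"
begin

definition clip :: "real \<Rightarrow> real \<Rightarrow> real \<Rightarrow> real" where
  "clip x x_max x_min = max (min x x_max) x_min"

definition controlled_rate ::
  "real \<Rightarrow> real \<Rightarrow> real \<Rightarrow> (real \<Rightarrow> real) \<Rightarrow> real \<Rightarrow> real \<Rightarrow> int \<Rightarrow> real" where
  "controlled_rate base \<epsilon> \<tau> \<phi> r_max r_min z =
     clip (base + \<epsilon> * \<phi> (real_of_int z / \<tau>)) r_max r_min"

text \<open>
  The arrivals of one system. Since for fixed \<open>z\<close> the variables \<open>a z k\<close> are identically
  distributed in \<open>k\<close>, the index \<open>k = 0\<close> serves as the generic copy. Measurability of all the
  arrivals is part of \<^const>\<open>prob_space.indep_vars\<close>.
\<close>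

locale matching_arrivals = prob_space M for M :: "'w measure" +
  fixes a\<^sub>c a\<^sub>s :: "int \<Rightarrow> nat \<Rightarrow> 'w \<Rightarrow> nat"
    and rate_c rate_s :: "int \<Rightarrow> real"
    and \<sigma>\<^sub>c \<sigma>\<^sub>s :: "real \<Rightarrow> real"
    and C :: real
  assumes indep_arrivals:
      "indep_vars (\<lambda>_. count_space UNIV) (case_sum (case_prod a\<^sub>c) (case_prod a\<^sub>s)) UNIV"
    and ident_c: "\<And>z k. distr M (count_space UNIV) (a\<^sub>c z k) = distr M (count_space UNIV) (a\<^sub>c z 0)"
    and ident_s: "\<And>z k. distr M (count_space UNIV) (a\<^sub>s z k) = distr M (count_space UNIV) (a\<^sub>s z 0)"
    and third_integrable_c: "\<And>z. integrable M (\<lambda>\<omega>. \<bar>real (a\<^sub>c z 0 \<omega>)\<bar> ^ 3)"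
    and third_integrable_s: "\<And>z. integrable M (\<lambda>\<omega>. \<bar>real (a\<^sub>s z 0 \<omega>)\<bar> ^ 3)"
    and third_moment_c: "\<And>z. expectation (\<lambda>\<omega>. \<bar>real (a\<^sub>c z 0 \<omega>)\<bar> ^ 3) \<le> C"
    and third_moment_s: "\<And>z. expectation (\<lambda>\<omega>. \<bar>real (a\<^sub>s z 0 \<omega>)\<bar> ^ 3) \<le> C"
    and mean_c: "\<And>z. expectation (\<lambda>\<omega>. real (a\<^sub>c z 0 \<omega>)) = rate_c z"
    and mean_s: "\<And>z. expectation (\<lambda>\<omega>. real (a\<^sub>s z 0 \<omega>)) = rate_s z"
    and var_c: "\<And>z. variance (\<lambda>\<omega>. real (a\<^sub>c z 0 \<omega>)) = \<sigma>\<^sub>c (rate_c z)"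
    and var_s: "\<And>z. variance (\<lambda>\<omega>. real (a\<^sub>s z 0 \<omega>)) = \<sigma>\<^sub>s (rate_s z)"

text \<open>
  The imbalance recursion from an arbitrary initial state \<open>x\<close>; the imbalance process of the
  queue is the case \<open>x = 0\<close>. For \<^locale>\<open>matching_arrivals\<close>, the law of
  \<open>imbalance a\<^sub>c a\<^sub>s x\<close> is the law of one and the same Markov chain started at \<open>x\<close>, so that the
  textbook notions for the chain (which quantify over the starting state) are expressed
  through it.
\<close>

primrec imbalance ::
  "(int \<Rightarrow> nat \<Rightarrow> 'w \<Rightarrow> nat) \<Rightarrow> (int \<Rightarrow> nat \<Rightarrow> 'w \<Rightarrow> nat) \<Rightarrow> int \<Rightarrow> nat \<Rightarrow> 'w \<Rightarrow> int" where
  "imbalance a\<^sub>c a\<^sub>s x 0 \<omega> = x"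
| "imbalance a\<^sub>c a\<^sub>s x (Suc k) \<omega> =
     imbalance a\<^sub>c a\<^sub>s x k \<omega> + int (a\<^sub>c (imbalance a\<^sub>c a\<^sub>s x k \<omega>) k \<omega>)
                       - int (a\<^sub>s (imbalance a\<^sub>c a\<^sub>s x k \<omega>) k \<omega>)"

definition transition_prob ::
  "'w measure \<Rightarrow> (int \<Rightarrow> nat \<Rightarrow> 'w \<Rightarrow> nat) \<Rightarrow> (int \<Rightarrow> nat \<Rightarrow> 'w \<Rightarrow> nat)
    \<Rightarrow> nat \<Rightarrow> int \<Rightarrow> int \<Rightarrow> real" where
  "transition_prob M a\<^sub>c a\<^sub>s n x y = measure M {\<omega> \<in> space M. imbalance a\<^sub>c a\<^sub>s x n \<omega> = y}"

definition irreducible_chain ::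
  "'w measure \<Rightarrow> (int \<Rightarrow> nat \<Rightarrow> 'w \<Rightarrow> nat) \<Rightarrow> (int \<Rightarrow> nat \<Rightarrow> 'w \<Rightarrow> nat) \<Rightarrow> bool" where
  "irreducible_chain M a\<^sub>c a\<^sub>s \<longleftrightarrow> (\<forall>x y. \<exists>n. transition_prob M a\<^sub>c a\<^sub>s n x y > 0)"

definition aperiodic_chain ::
  "'w measure \<Rightarrow> (int \<Rightarrow> nat \<Rightarrow> 'w \<Rightarrow> nat) \<Rightarrow> (int \<Rightarrow> nat \<Rightarrow> 'w \<Rightarrow> nat) \<Rightarrow> bool" where
  "aperiodic_chain M a\<^sub>c a\<^sub>s \<longleftrightarrow>
     (\<forall>x. Gcd {n. 1 \<le> n \<and> transition_prob M a\<^sub>c a\<^sub>s n x x > 0} = 1)"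

text \<open>The infimum of the empty set is \<open>\<infinity>\<close>: a path that never returns has infinite return time.\<close>

definition return_time ::
  "(int \<Rightarrow> nat \<Rightarrow> 'w \<Rightarrow> nat) \<Rightarrow> (int \<Rightarrow> nat \<Rightarrow> 'w \<Rightarrow> nat) \<Rightarrow> int \<Rightarrow> 'w \<Rightarrow> ennreal" where
  "return_time a\<^sub>c a\<^sub>s x \<omega> = (INF n\<in>{n. 1 \<le> n \<and> imbalance a\<^sub>c a\<^sub>s x n \<omega> = x}. of_nat n)"

definition positive_recurrent_chain ::
  "'w measure \<Rightarrow> (int \<Rightarrow> nat \<Rightarrow> 'w \<Rightarrow> nat) \<Rightarrow> (int \<Rightarrow> nat \<Rightarrow> 'w \<Rightarrow> nat) \<Rightarrow> bool" where
  "positive_recurrent_chain M a\<^sub>c a\<^sub>s \<longleftrightarrow>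
     (\<forall>x. (\<integral>\<^sup>+ \<omega>. return_time a\<^sub>c a\<^sub>s x \<omega> \<partial>M) < \<infinity>)"

definition stationary_distribution ::
  "'w measure \<Rightarrow> (int \<Rightarrow> nat \<Rightarrow> 'w \<Rightarrow> nat) \<Rightarrow> (int \<Rightarrow> nat \<Rightarrow> 'w \<Rightarrow> nat) \<Rightarrow> int measure \<Rightarrow> bool" where
  "stationary_distribution M a\<^sub>c a\<^sub>s \<nu> \<longleftrightarrow>
     prob_space \<nu> \<and> sets \<nu> = UNIV \<and>
     (\<forall>y. ((\<lambda>x. measure \<nu> {x} * transition_prob M a\<^sub>c a\<^sub>s 1 x y) has_sum measure \<nu> {y}) UNIV)"

definition limit_gap :: "(real \<Rightarrow> real) \<Rightarrow> (real \<Rightarrow> real) \<Rightarrow> real \<Rightarrow> real" where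
  "limit_gap \<phi>\<^sub>c \<phi>\<^sub>s x =
     (if x \<ge> 0 then Lim at_top \<phi>\<^sub>s - Lim at_top \<phi>\<^sub>c else Lim at_bot \<phi>\<^sub>s - Lim at_bot \<phi>\<^sub>c)"

definition asym_laplace_density :: "real \<Rightarrow> real \<Rightarrow> real \<Rightarrow> real \<Rightarrow> real" where
  "asym_laplace_density m l \<kappa> x =
     (if x < m then l / (\<kappa> + 1 / \<kappa>) * exp (l / \<kappa> * (x - m))
      else l / (\<kappa> + 1 / \<kappa>) * exp (- l * \<kappa> * (x - m)))"

definition asym_laplace :: "real \<Rightarrow> real \<Rightarrow> real \<Rightarrow> real measure" where
  "asym_laplace m l \<kappa> = density lborel (\<lambda>x. ennreal (asym_laplace_density m l \<kappa> x))"

text \<open>\<^const>\<open>weak_conv_m\<close> is for sequences only; this is its definition along an arbitrary filter.\<close>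

definition weak_conv_along :: "('i \<Rightarrow> real measure) \<Rightarrow> real measure \<Rightarrow> 'i filter \<Rightarrow> bool" where
  "weak_conv_along \<mu> L F \<longleftrightarrow>
     (\<forall>x. isCont (cdf L) x \<longrightarrow> ((\<lambda>i. cdf (\<mu> i) x) \<longlongrightarrow> cdf L x) F)"

end

theory Submission
  imports Defs
begin

text \<open>
  Put \<open>X = \<epsilon> * zbar\<close>. The hypotheses force \<open>\<epsilon> \<longlonglongrightarrow> 0\<close>: this is one of the two alternatives, and
  otherwise \<open>\<tau>\<close> diverges while \<open>\<epsilon> * \<tau>\<close> vanishes. The control curves have finite limits and obey a
  power bound, hence they are bounded, and for large \<open>\<eta>\<close> the clipping of the rates is inactive.
  The chain then has drift \<open>\<epsilon> * \<psi> X\<close>, where \<open>\<psi> x = \<phi>\<^sub>c (x / (\<epsilon> * \<tau>)) - \<phi>\<^sub>s (x / (\<epsilon> * \<tau>))\<close> tends to a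
  negative constant \<open>-a\<close> on the right of 0 and to a positive constant \<open>b\<close> on the left, uniformly
  away from 0, because \<open>\<epsilon> * \<tau>\<close> vanishes. The second moment of its jumps tends uniformly to
  \<open>s = \<sigma>\<^sub>c lam_star + \<sigma>\<^sub>s mu_star\<close>, and the third moments are bounded.

  In the stationary regime \<open>f X\<close> has mean increment zero over one step. A second-order Taylor
  expansion, divided by \<open>\<epsilon>\<^sup>2\<close>, gives \<open>E (\<psi> X * g X + s / 2 * h X) \<longlonglongrightarrow> 0\<close> for \<open>g = f'\<close>, \<open>h = f''\<close>,
  as soon as \<open>g\<close> and \<open>h\<close> are bounded and \<open>h\<close> is Lipschitz
  (\<open>stationary_generator_approx\<close>). Such \<open>f\<close> may grow linearly while \<open>X\<close> need not be
  integrable, so the stationary identity is extended from bounded to Lipschitz \<open>f\<close> by truncation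
  (\<open>stationary_expectation_lipschitz\<close>).

  The limit law is read off from this asymptotic equation by a few choices of \<open>g\<close>, in the locale
  \<open>diffusion_limit\<close>. A smoothed sign function of width and size \<open>r\<close> shows that the mass of
  \<open>{-r..r}\<close> is of order \<open>r\<close> (\<open>no_concentration_at_zero\<close>), so the irregular drift near 0 can be
  ignored. Trigonometric functions cut off at 0 show that the characteristic function restricted to
  \<open>{0..}\<close> is asymptotically that of an exponential law of rate \<open>2 * a / s\<close>, times the mass of
  \<open>{0..}\<close>; by reflection the rate on the left is \<open>2 * b / s\<close>. The constant \<open>g = 1\<close> says that the
  mean drift vanishes, so the masses of the two half-lines are in the ratio \<open>b\<close> to \<open>a\<close>
  (\<open>mass_balance\<close>). The resulting limit is the characteristic function of the asymmetric Laplace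
  law, and Levy's continuity theorem concludes.
\<close>

section \<open>The asymmetric Laplace law\<close>

lemma exponential_integral_half_line:
  fixes w :: complex
  assumes "Re w < 0"
  shows "integrable lborel (\<lambda>x. indicator {0<..} x *\<^sub>R exp (w * of_real x))" (is ?int)
    and "(\<integral>x. indicator {0<..} x *\<^sub>R exp (w * of_real x) \<partial>lborel) = - 1 / w" (is ?val)
proof -
  have w: "w \<noteq> 0" using assms by auto
  have nrm: "norm (exp (w * of_real x)) = exp (- (x * - Re w))" for x
    by (simp add: norm_exp_eq_Re mult.commute)
  have "integrable lborel (\<lambda>x. indicator {0<..} x *\<^sub>R exp (- (x * - Re w)))"
    using integrable_I0i_exp_mscale[of "- Re w"] assms by (simp add: set_integrable_def)
  then show int: ?int
    by (rule Bochner_Integration.integrable_bound) (auto simp: nrm simp del: norm_exp_eq_Re)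
  have "(LBINT x=0..\<infinity>. exp (w * of_real x)) = 0 - 1 / w"
  proof (rule interval_integral_FTC_integrable)
    show "((\<lambda>x. exp (w * of_real x) / w) has_vector_derivative exp (w * of_real x)) (at x)" for x :: real
    proof -
      have "((\<lambda>z. exp (w * z) / w) has_field_derivative exp (w * of_real x)) (at (of_real x))"
        using w by (auto intro!: derivative_eq_intros)
      from has_vector_derivative_real_field[OF this] show ?thesis .
    qed
    show "set_integrable lborel (einterval 0 \<infinity>) (\<lambda>x. exp (w * of_real x))"
      using int by (simp add: set_integrable_def zero_ereal_def)
    show "(((\<lambda>x. exp (w * of_real x) / w) \<circ> real_of_ereal) \<longlongrightarrow> 1 / w) (at_right 0)"
      using w by (auto simp: zero_ereal_def ereal_tendsto_simps intro!: tendsto_eq_intros)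
    have "((\<lambda>x. exp (- (x * - Re w))) \<longlongrightarrow> 0) at_top"
    proof (rule filterlim_compose[OF exp_at_bot])
      have "filterlim (\<lambda>x. - Re w * x) at_top at_top"
        by (rule filterlim_tendsto_pos_mult_at_top[OF tendsto_const _ filterlim_ident]) (use assms in simp)
      then show "filterlim (\<lambda>x. - (x * - Re w)) at_bot at_top"
        unfolding filterlim_uminus_at_bot by (simp add: mult.commute)
    qed
    then have "((\<lambda>x. exp (w * of_real x)) \<longlongrightarrow> 0) at_top"
      unfolding nrm[symmetric] by (rule tendsto_norm_zero_cancel)
    from tendsto_divide[OF this tendsto_const[of w]] w
    show "(((\<lambda>x. exp (w * of_real x) / w) \<circ> real_of_ereal) \<longlongrightarrow> 0) (at_left \<infinity>)"
      by (simp add: ereal_tendsto_simps)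
  qed (auto intro!: continuous_intros)
  then show ?val
    by (simp add: interval_lebesgue_integral_0_infty set_lebesgue_integral_def)
qed

text \<open>
  The law is a mixture of an exponential law and the reflection of another, of rates \<open>l * \<kappa>\<close> and
  \<open>l / \<kappa>\<close>. The transform is computed for all \<open>t\<close> at once; its value at \<open>t = 0\<close> is the total mass.
\<close>

lemma
  fixes l \<kappa> :: real
  assumes "l > 0" "\<kappa> > 0"
  shows real_distribution_asym_laplace: "real_distribution (asym_laplace 0 l \<kappa>)"
    and char_asym_laplace: "char (asym_laplace 0 l \<kappa>) t =
      of_real (l / (\<kappa> + 1 / \<kappa>)) * (1 / (of_real (l * \<kappa>) - \<i> * of_real t) + 1 / (of_real (l / \<kappa>) + \<i> * of_real t))"
proof -
  define k where "k = l / (\<kappa> + 1 / \<kappa>)"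
  let ?d = "asym_laplace_density 0 l \<kappa>"
  have k: "k > 0" using assms by (simp add: k_def add_pos_pos)
  have [measurable]: "?d \<in> borel_measurable borel"
    unfolding asym_laplace_density_def by measurable
  have nonneg: "?d x \<ge> 0" for x
    using k by (simp add: asym_laplace_density_def k_def[symmetric])
  have bochner: "has_bochner_integral lborel (\<lambda>x. ?d x *\<^sub>R iexp (t * x))
      (of_real k * (1 / (of_real (l * \<kappa>) - \<i> * of_real t) + 1 / (of_real (l / \<kappa>) + \<i> * of_real t)))" for t
  proof -
    define w v where "w = \<i> * of_real t - of_real (l * \<kappa>)" and "v = - \<i> * of_real t - of_real (l / \<kappa>)"
    let ?E = "\<lambda>z x. indicator {0<..} x *\<^sub>R exp (z * of_real x)"
    have Re: "Re w < 0" "Re v < 0" using assms by (simp_all add: w_def v_def)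
    have W: "has_bochner_integral lborel (?E w) (- 1 / w)"
      using exponential_integral_half_line[OF Re(1)] by (simp add: has_bochner_integral_iff)
    have V: "has_bochner_integral lborel (?E v) (- 1 / v)"
      using exponential_integral_half_line[OF Re(2)] by (simp add: has_bochner_integral_iff)
    have "has_bochner_integral lborel (\<lambda>x. ?E v (0 + - 1 * x)) ((- 1 / v) /\<^sub>R \<bar>- 1\<bar>)"
      by (subst lborel_has_bochner_integral_real_affine_iff[symmetric]) (use V in auto)
    then have V': "has_bochner_integral lborel (\<lambda>x. ?E v (- x)) (- 1 / v)"
      by simp
    have "has_bochner_integral lborel (\<lambda>x. of_real k * (?E w x + ?E v (- x))) (of_real k * (- 1 / w + - 1 / v))"
      by (intro has_bochner_integral_mult_right has_bochner_integral_add W V')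
    also have "?this \<longleftrightarrow> has_bochner_integral lborel (\<lambda>x. ?d x *\<^sub>R iexp (t * x)) (of_real k * (- 1 / w + - 1 / v))"
    proof (rule has_bochner_integral_cong_AE)
      have d: "?d x = (if x < 0 then k * exp (l / \<kappa> * x) else k * exp (- l * \<kappa> * x))" for x
        by (simp add: asym_laplace_density_def k_def)
      have "of_real k * (?E w x + ?E v (- x)) = ?d x *\<^sub>R iexp (t * x)" if "x \<noteq> 0" for x
      proof (cases "x < 0")
        case True
        have "exp (v * of_real (- x)) = exp (of_real (l / \<kappa> * x)) * iexp (t * x)"
          unfolding exp_add[symmetric] by (simp add: v_def algebra_simps)
        then show ?thesis using True by (simp add: d scaleR_conv_of_real flip: exp_of_real)
      next
        case False
        have "exp (w * of_real x) = exp (of_real (- l * \<kappa> * x)) * iexp (t * x)"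
          unfolding exp_add[symmetric] by (simp add: w_def algebra_simps)
        then show ?thesis using False that by (simp add: d scaleR_conv_of_real flip: exp_of_real)
      qed
      then show "AE x in lborel. of_real k * (?E w x + ?E v (- x)) = ?d x *\<^sub>R iexp (t * x)"
        using AE_lborel_singleton[of 0] by (auto elim: eventually_mono)
    qed measurable
    also have "- 1 / w + - 1 / v = 1 / (of_real (l * \<kappa>) - \<i> * of_real t) + 1 / (of_real (l / \<kappa>) + \<i> * of_real t)"
    proof -
      have "- 1 / w = 1 / - w" "- 1 / v = 1 / - v" by simp_all
      then show ?thesis by (simp add: w_def v_def)
    qed
    finally show ?thesis .
  qed
  have "l * \<kappa> > 0" "l / \<kappa> > 0" using assms by auto
  have one: "k * (1 / (l * \<kappa>) + 1 / (l / \<kappa>)) = 1"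
  proof -
    have "1 / (l * \<kappa>) + 1 / (l / \<kappa>) = (\<kappa> + 1 / \<kappa>) / l" using assms by (simp add: field_simps)
    moreover have "\<kappa> + 1 / \<kappa> > 0" using assms by (simp add: add_pos_pos)
    ultimately show ?thesis using assms by (simp add: k_def)
  qed
  have "has_bochner_integral lborel (\<lambda>x. of_real (?d x)) (of_real (k * (1 / (l * \<kappa>) + 1 / (l / \<kappa>))) :: complex)"
    using bochner[of 0] by (simp add: scaleR_conv_of_real)
  then have "has_bochner_integral lborel ?d 1"
    unfolding one by (simp add: has_bochner_integral_iff integral_complex_of_real complex_of_real_integrable_eq)
  then have "(\<integral>\<^sup>+x. ennreal (?d x) \<partial>lborel) = 1"
    using nonneg by (subst nn_integral_eq_integral) (auto simp: has_bochner_integral_iff)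
  then have prob: "prob_space (asym_laplace 0 l \<kappa>)"
    by (intro prob_spaceI) (simp add: asym_laplace_def emeasure_density)
  then show "real_distribution (asym_laplace 0 l \<kappa>)"
    by (intro real_distribution.intro real_distribution_axioms.intro) (auto simp: asym_laplace_def)
  show "char (asym_laplace 0 l \<kappa>) t =
      of_real (l / (\<kappa> + 1 / \<kappa>)) * (1 / (of_real (l * \<kappa>) - \<i> * of_real t) + 1 / (of_real (l / \<kappa>) + \<i> * of_real t))"
    unfolding char_def asym_laplace_def k_def[symmetric] has_bochner_integral_integral_eq[OF bochner[of t], symmetric]
    by (subst integral_density) (auto simp: nonneg)
qed

section \<open>Stationary expectations of the imbalance chain\<close>

lemma second_order_taylor_lipschitz:
  fixes f g h :: "real \<Rightarrow> real"
  assumes f: "\<And>x. (f has_real_derivative g x) (at x)"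
    and g: "\<And>x. (g has_real_derivative h x) (at x)"
    and h: "\<And>x y. \<bar>h x - h y\<bar> \<le> L * \<bar>x - y\<bar>"
  shows "\<bar>f (x + t) - f x - (t * g x + t\<^sup>2 / 2 * h x)\<bar> \<le> L / 2 * \<bar>t\<bar> ^ 3"
proof (cases "t = 0")
  case False
  define diff where "diff m = (if m = 0 then f else if m = 1 then g else h)" for m :: nat
  have D: "\<forall>m s. m < (2::nat) \<and> min x (x+t) \<le> s \<and> s \<le> max x (x+t) \<longrightarrow> DERIV (diff m) s :> diff (Suc m) s"
    using f g by (auto simp: diff_def less_2_cases_iff)
  obtain s where s: "if x + t < x then x + t < s \<and> s < x else x < s \<and> s < x + t"
    and eq: "f (x + t) = (\<Sum>m<2. diff m x / fact m * (x + t - x) ^ m) + diff 2 s / fact 2 * (x + t - x) ^ 2"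
    using Taylor[of 2 diff f "min x (x+t)" "max x (x+t)" x "x+t"] D False
    by (auto simp: diff_def)
  have "f (x + t) - f x - (t * g x + t\<^sup>2 / 2 * h x) = t\<^sup>2 / 2 * (h s - h x)"
    using eq by (simp add: diff_def lessThan_Suc numeral_2_eq_2 fact_Suc field_simps)
  also have "\<bar>\<dots>\<bar> = t\<^sup>2 / 2 * \<bar>h s - h x\<bar>"
    by (simp add: abs_mult)
  also have "\<dots> \<le> t\<^sup>2 / 2 * (L * \<bar>s - x\<bar>)"
    by (intro mult_left_mono h) auto
  also have "\<dots> \<le> t\<^sup>2 / 2 * (L * \<bar>t\<bar>)"
  proof (intro mult_left_mono)
    show "\<bar>s - x\<bar> \<le> \<bar>t\<bar>" using s by (auto split: if_splits)
    show "0 \<le> L" using h[of 1 0] by simp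
  qed auto
  also have "\<dots> = L / 2 * \<bar>t\<bar> ^ 3"
    by (simp add: power3_eq_cube power2_eq_square abs_mult)
  finally show ?thesis .
qed auto

text \<open>
  The stationarity equations are stated with unordered sums; this turns them into integrals.
  Every \<open>\<sigma>\<close>-finite measure on the integers is a density over counting measure.
\<close>

lemma integral_int_measure_eq_infsum:
  fixes f :: "int \<Rightarrow> real"
  assumes "prob_space \<nu>" "sets \<nu> = UNIV"
    and f: "\<And>x. 0 \<le> f x" "(\<lambda>x. measure \<nu> {x} * f x) summable_on UNIV"
  shows "(\<integral>x. f x \<partial>\<nu>) = (\<Sum>\<^sub>\<infinity>x. measure \<nu> {x} * f x)"
proof -
  interpret prob_space \<nu> by fact
  have "\<nu> = density (count_space UNIV) (\<lambda>x. ennreal (measure \<nu> {x}))"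
    using assms by (intro measure_eqI_countable[of _ UNIV])
      (auto simp: emeasure_density emeasure_eq_measure nn_integral_count_space_indicator[symmetric]
         max_def intro!: nn_integral_count_space'[symmetric])
  then have "(\<integral>x. f x \<partial>\<nu>) = (\<integral>x. f x \<partial>density (count_space UNIV) (\<lambda>x. ennreal (measure \<nu> {x})))"
    by simp
  also have "\<dots> = (\<Sum>\<^sub>ax. measure \<nu> {x} * f x)"
    by (subst integral_density) (auto simp: infsetsum_def)
  also have "\<dots> = (\<Sum>\<^sub>\<infinity>x. measure \<nu> {x} * f x)"
    using f by (intro infsetsum_infsum) (auto simp flip: abs_summable_equivalent)
  finally show ?thesis .
qed

text \<open>
  The equations for the point masses say that \<open>\<nu>\<close> is a fixed point of the one-step kernel in the
  Giry monad, so one step from \<open>\<nu>\<close> leaves the expectation of every bounded function unchanged.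
\<close>

lemma stationary_expectation_bounded:
  fixes f :: "int \<Rightarrow> real"
  assumes "prob_space M"
    and step: "\<And>x. imbalance a\<^sub>c a\<^sub>s x 1 \<in> measurable M (count_space UNIV)"
    and stat: "stationary_distribution M a\<^sub>c a\<^sub>s \<nu>"
    and f: "\<And>x. \<bar>f x\<bar> \<le> B"
  shows "(\<integral>x. (\<integral>\<omega>. f (imbalance a\<^sub>c a\<^sub>s x 1 \<omega>) \<partial>M) \<partial>\<nu>) = (\<integral>x. f x \<partial>\<nu>)"
proof -
  interpret M: prob_space M by fact
  interpret \<nu>: prob_space \<nu> using stat by (simp add: stationary_distribution_def)
  have sets[simp, measurable_cong]: "sets \<nu> = sets (count_space UNIV)"
    using stat by (simp add: stationary_distribution_def)
  have space[simp]: "space \<nu> = UNIV"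
    using sets_eq_imp_space_eq[OF sets] by simp
  define K where "K x = distr M (count_space UNIV) (imbalance a\<^sub>c a\<^sub>s x 1)" for x
  have prob_K: "prob_space (K x)" for x
    unfolding K_def by (rule M.prob_space_distr[OF step])
  have K: "K \<in> measurable \<nu> (subprob_algebra (count_space UNIV))"
    by (auto simp: measurable_def space_subprob_algebra prob_K prob_space_imp_subprob_space)
       (auto simp: K_def)
  have "\<nu> \<bind> K = \<nu>"
  proof (rule measure_eqI_countable[of _ UNIV])
    show "sets (\<nu> \<bind> K) = Pow UNIV"
      using K by (subst sets_bind[of _ _ "count_space UNIV"]) (auto simp: K_def)
  next
    interpret \<nu>K: prob_space "\<nu> \<bind> K"
      by (rule \<nu>.prob_space_bind[OF _ K]) (simp add: prob_K)
    fix y :: int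
    have "measure (K x) {y} = transition_prob M a\<^sub>c a\<^sub>s 1 x y" for x
      using step[of x] unfolding K_def transition_prob_def
      by (subst measure_distr) (auto intro!: arg_cong[where f="measure M"])
    then have "measure (\<nu> \<bind> K) {y} = (\<integral>x. transition_prob M a\<^sub>c a\<^sub>s 1 x y \<partial>\<nu>)"
      by (subst \<nu>.measure_bind[OF K]) auto
    also have "\<dots> = measure \<nu> {y}"
      using stat \<nu>.prob_space_axioms
      by (subst integral_int_measure_eq_infsum)
         (auto simp: stationary_distribution_def transition_prob_def intro: infsumI has_sum_imp_summable)
    finally show "emeasure (\<nu> \<bind> K) {y} = emeasure \<nu> {y}"
      by (simp add: \<nu>K.emeasure_eq_measure \<nu>.emeasure_eq_measure)
  qed auto
  then have "(\<integral>x. f x \<partial>\<nu>) = (\<integral>x. f x \<partial>(\<nu> \<bind> K))"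
    by simp
  also have "\<dots> = (\<integral>x. (\<integral>y. f y \<partial>K x) \<partial>\<nu>)"
    using K prob_K
    by (intro integral_bind[where K="count_space UNIV" and B=B and B'=1])
       (auto simp: f prob_space.emeasure_space_1 \<nu>.finite_measure_axioms)
  also have "\<dots> = (\<integral>x. (\<integral>\<omega>. f (imbalance a\<^sub>c a\<^sub>s x 1 \<omega>) \<partial>M) \<partial>\<nu>)"
    using step by (simp add: K_def integral_distr)
  finally show ?thesis by simp
qed

lemma abs_integral_le_integral:
  fixes f g :: "'a \<Rightarrow> real"
  assumes "integrable M f" "integrable M g" "\<And>x. \<bar>f x\<bar> \<le> g x"
  shows "\<bar>\<integral>x. f x \<partial>M\<bar> \<le> (\<integral>x. g x \<partial>M)"
proof -
  have "\<bar>\<integral>x. f x \<partial>M\<bar> \<le> (\<integral>x. \<bar>f x\<bar> \<partial>M)"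
    using integral_norm_bound[of M f] by simp
  also have "\<dots> \<le> (\<integral>x. g x \<partial>M)"
    using assms by (intro integral_mono) auto
  finally show ?thesis .
qed

text \<open>
  For an unbounded \<open>f\<close> the expectation of \<open>f\<close> under \<open>\<nu>\<close> may fail to exist, but the expected
  increment over one step is bounded. Clipping \<open>f\<close> at \<open>\<plusminus>n\<close> does not increase increments, so
  dominated convergence extends the identity from bounded functions to Lipschitz ones.
\<close>

lemma stationary_expectation_lipschitz:
  fixes f :: "int \<Rightarrow> real"
  assumes "prob_space M"
    and step: "\<And>x. imbalance a\<^sub>c a\<^sub>s x 1 \<in> measurable M (count_space UNIV)"
    and stat: "stationary_distribution M a\<^sub>c a\<^sub>s \<nu>"
    and f: "\<And>x y. \<bar>f x - f y\<bar> \<le> L * \<bar>real_of_int x - real_of_int y\<bar>"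
    and jump: "\<And>x. integrable M (\<lambda>\<omega>. \<bar>real_of_int (imbalance a\<^sub>c a\<^sub>s x 1 \<omega>) - real_of_int x\<bar>)"
      "\<And>x. (\<integral>\<omega>. \<bar>real_of_int (imbalance a\<^sub>c a\<^sub>s x 1 \<omega>) - real_of_int x\<bar> \<partial>M) \<le> D"
  shows "(\<integral>x. (\<integral>\<omega>. f (imbalance a\<^sub>c a\<^sub>s x 1 \<omega>) - f x \<partial>M) \<partial>\<nu>) = 0"
proof -
  interpret M: prob_space M by fact
  interpret \<nu>: prob_space \<nu> using stat by (simp add: stationary_distribution_def)
  have sets[simp, measurable_cong]: "sets \<nu> = sets (count_space UNIV)"
    using stat by (simp add: stationary_distribution_def)
  define J where "J x = imbalance a\<^sub>c a\<^sub>s x 1" for x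
  note step' = step[folded J_def] and jump' = jump[folded J_def]
  note step'[measurable]
  have L: "L \<ge> 0" using f[of 1 0] by simp
  define c where "c n v = clip v (real n) (- real n)" for n v
  have c_bound: "\<bar>c n v\<bar> \<le> real n" for n v by (auto simp: c_def clip_def)
  have c_lip: "\<bar>c n v - c n w\<bar> \<le> \<bar>v - w\<bar>" for n v w by (auto simp: c_def clip_def min_def max_def)
  have c_lim: "(\<lambda>n. c n v) \<longlonglongrightarrow> v" for v
  proof (rule tendsto_eventually)
    show "\<forall>\<^sub>F n in sequentially. c n v = v"
      using eventually_ge_at_top[of "nat \<lceil>\<bar>v\<bar>\<rceil>"]
      by eventually_elim (auto simp: c_def clip_def min_def max_def nat_le_iff ceiling_le_iff)
  qed
  let ?P = "\<lambda>F x. (\<integral>\<omega>. F (f (J x \<omega>)) - F (f x) \<partial>M)"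
  have dom: "\<bar>c n (f (J x \<omega>)) - c n (f x)\<bar>
      \<le> L * \<bar>real_of_int (J x \<omega>) - real_of_int x\<bar>" for n x \<omega>
    using c_lip[of n "f (J x \<omega>)" "f x"] f[of "J x \<omega>" x] by linarith
  have lim: "(\<lambda>n. ?P (c n) x) \<longlonglongrightarrow> ?P (\<lambda>v. v) x" for x
    by (rule integral_dominated_convergence
        [where w="\<lambda>\<omega>. L * \<bar>real_of_int (J x \<omega>) - real_of_int x\<bar>"])
       (use jump' dom in \<open>auto intro!: tendsto_intros c_lim\<close>)
  have bound: "\<bar>?P (c n) x\<bar> \<le> L * D" for n x
  proof -
    have "\<bar>?P (c n) x\<bar> \<le> (\<integral>\<omega>. L * \<bar>real_of_int (J x \<omega>) - real_of_int x\<bar> \<partial>M)"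
      using dom jump' L by (intro abs_integral_le_integral) 
         (auto intro!: Bochner_Integration.integrable_bound[OF integrable_mult_right[OF jump'(1)[of x], of L]] simp: abs_mult)
    also have "\<dots> \<le> L * D" using jump'(2)[of x] L by (simp add: mult_left_mono)
    finally show ?thesis .
  qed
  have "(\<lambda>n. \<integral>x. ?P (c n) x \<partial>\<nu>) \<longlonglongrightarrow> (\<integral>x. ?P (\<lambda>v. v) x \<partial>\<nu>)"
    by (rule integral_dominated_convergence[where w="\<lambda>_. L * D"])
       (use lim bound in auto)
  moreover have "(\<integral>x. ?P (c n) x \<partial>\<nu>) = 0" for n
  proof -
    have int: "integrable M (\<lambda>\<omega>. c n (f (J x \<omega>)))" for x
      by (rule M.integrable_const_bound[where B="real n"]) (auto simp: c_bound)
    have "\<bar>\<integral>\<omega>. c n (f (J x \<omega>)) \<partial>M\<bar> \<le> (\<integral>\<omega>. real n \<partial>M)" for x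
      using int[of x] by (intro abs_integral_le_integral) (auto simp: c_bound)
    then have int': "integrable \<nu> (\<lambda>x. \<integral>\<omega>. c n (f (J x \<omega>)) \<partial>M)"
      by (intro \<nu>.integrable_const_bound[where B="real n"]) (auto simp: M.prob_space)
    have int'': "integrable \<nu> (\<lambda>x. c n (f x))"
      by (rule \<nu>.integrable_const_bound[where B="real n"]) (auto simp: c_bound)
    have "(\<integral>x. ?P (c n) x \<partial>\<nu>) = (\<integral>x. (\<integral>\<omega>. c n (f (J x \<omega>)) \<partial>M) - c n (f x) \<partial>\<nu>)"
      using int by (simp add: M.prob_space)
    also have "\<dots> = 0"
      using stationary_expectation_bounded[OF assms(1) step stat, of "\<lambda>x. c n (f x)" "real n", folded J_def] int' int''
      by (simp add: c_bound)
    finally show ?thesis .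
  qed
  ultimately show ?thesis by (simp add: LIMSEQ_const_iff J_def)
qed

lemma abs_le_one_plus_cube: "\<bar>x\<bar> \<le> 1 + \<bar>x\<bar> ^ 3" and square_le_one_plus_cube: "x\<^sup>2 \<le> 1 + \<bar>x\<bar> ^ 3" for x :: real
proof -
  have "\<bar>x\<bar> \<le> 1 + \<bar>x\<bar> ^ 3 \<and> \<bar>x\<bar>\<^sup>2 \<le> 1 + \<bar>x\<bar> ^ 3"
  proof (cases "\<bar>x\<bar> \<le> 1")
    case True
    then have "\<bar>x\<bar>\<^sup>2 \<le> 1" "0 \<le> \<bar>x\<bar> ^ 3" using power_le_one[of "\<bar>x\<bar>" 2] by auto
    with True show ?thesis by linarith
  next
    case False
    then have "\<bar>x\<bar> ^ 1 \<le> \<bar>x\<bar> ^ 3" "\<bar>x\<bar>\<^sup>2 \<le> \<bar>x\<bar> ^ 3" by (intro power_increasing; simp)+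
    then show ?thesis by simp
  qed
  then show "\<bar>x\<bar> \<le> 1 + \<bar>x\<bar> ^ 3" "x\<^sup>2 \<le> 1 + \<bar>x\<bar> ^ 3" by simp_all
qed

lemma cube_abs_diff_le:
  fixes x y :: real
  assumes "x \<ge> 0" "y \<ge> 0"
  shows "\<bar>x - y\<bar> ^ 3 \<le> \<bar>x\<bar> ^ 3 + \<bar>y\<bar> ^ 3"
proof -
  have "\<bar>x - y\<bar> ^ 3 \<le> max x y ^ 3"
    using assms by (intro power_mono) auto
  also have "\<dots> \<le> x ^ 3 + y ^ 3"
    using assms by (simp add: max_def)
  finally show ?thesis using assms by simp
qed

context matching_arrivals
begin

definition jump :: "int \<Rightarrow> 'w \<Rightarrow> real" where
  "jump z \<omega> = real (a\<^sub>c z 0 \<omega>) - real (a\<^sub>s z 0 \<omega>)"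

text \<open>
  The second moment of the jump from \<open>z\<close>; see \<open>jump_square_mean\<close>.
\<close>

definition jump_square :: "int \<Rightarrow> real" where
  "jump_square z = \<sigma>\<^sub>c (rate_c z) + \<sigma>\<^sub>s (rate_s z) + (rate_c z - rate_s z)\<^sup>2"

lemma arrivals_measurable [measurable]:
  "a\<^sub>c z k \<in> measurable M (count_space UNIV)" "a\<^sub>s z k \<in> measurable M (count_space UNIV)"
proof -
  have *: "case_sum (case_prod a\<^sub>c) (case_prod a\<^sub>s) i \<in> measurable M (count_space UNIV)" for i
    using indep_arrivals unfolding indep_vars_def2 by blast
  show "a\<^sub>c z k \<in> measurable M (count_space UNIV)" "a\<^sub>s z k \<in> measurable M (count_space UNIV)"
    using *[of "Inl (z, k)"] *[of "Inr (z, k)"] by simp_all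
qed

lemma jump_measurable [measurable]: "jump z \<in> borel_measurable M"
  unfolding jump_def by measurable

lemma imbalance_one_measurable:
  "imbalance a\<^sub>c a\<^sub>s z 1 \<in> measurable M (count_space UNIV)"
proof -
  have *: "(\<lambda>\<omega>. z + int i - int (a\<^sub>s z 0 \<omega>)) \<in> measurable M (count_space UNIV)" for i
    by measurable
  have "(\<lambda>\<omega>. z + int (a\<^sub>c z 0 \<omega>) - int (a\<^sub>s z 0 \<omega>)) \<in> measurable M (count_space UNIV)"
    by (rule measurable_compose_countable[OF *]) measurable
  moreover have "imbalance a\<^sub>c a\<^sub>s z 1 = (\<lambda>\<omega>. z + int (a\<^sub>c z 0 \<omega>) - int (a\<^sub>s z 0 \<omega>))"
    by (simp add: fun_eq_iff)
  ultimately show ?thesis by simp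
qed

lemma imbalance_one: "real_of_int (imbalance a\<^sub>c a\<^sub>s z 1 \<omega>) = z + jump z \<omega>"
  by (simp add: jump_def)

lemma integrable_arrivals:
  "integrable M (\<lambda>\<omega>. real (a\<^sub>c z 0 \<omega>))" "integrable M (\<lambda>\<omega>. (real (a\<^sub>c z 0 \<omega>))\<^sup>2)"
  "integrable M (\<lambda>\<omega>. real (a\<^sub>s z 0 \<omega>))" "integrable M (\<lambda>\<omega>. (real (a\<^sub>s z 0 \<omega>))\<^sup>2)"
proof -
  have *: "integrable M (\<lambda>\<omega>. real (X \<omega>)) \<and> integrable M (\<lambda>\<omega>. (real (X \<omega>))\<^sup>2)"
    if [measurable]: "X \<in> measurable M (count_space UNIV)" and X: "integrable M (\<lambda>\<omega>. \<bar>real (X \<omega>)\<bar> ^ 3)"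
    for X :: "'w \<Rightarrow> nat"
  proof -
    have "integrable M (\<lambda>\<omega>. 1 + \<bar>real (X \<omega>)\<bar> ^ 3)" using X by simp
    then show ?thesis
    proof (intro conjI; rule Bochner_Integration.integrable_bound)
      show "AE \<omega> in M. norm (real (X \<omega>)) \<le> norm (1 + \<bar>real (X \<omega>)\<bar> ^ 3)"
        using abs_le_one_plus_cube[of "real (X _)"] by (intro AE_I2) (simp add: abs_of_nonneg)
      show "AE \<omega> in M. norm ((real (X \<omega>))\<^sup>2) \<le> norm (1 + \<bar>real (X \<omega>)\<bar> ^ 3)"
        using square_le_one_plus_cube[of "real (X _)"] by (intro AE_I2) (simp add: abs_of_nonneg)
    qed measurable
  qed
  show "integrable M (\<lambda>\<omega>. real (a\<^sub>c z 0 \<omega>))" "integrable M (\<lambda>\<omega>. (real (a\<^sub>c z 0 \<omega>))\<^sup>2)"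
    using *[OF _ third_integrable_c] by auto
  show "integrable M (\<lambda>\<omega>. real (a\<^sub>s z 0 \<omega>))" "integrable M (\<lambda>\<omega>. (real (a\<^sub>s z 0 \<omega>))\<^sup>2)"
    using *[OF _ third_integrable_s] by auto
qed

lemma indep_arrivals_pair:
  "indep_var borel (\<lambda>\<omega>. real (a\<^sub>c z 0 \<omega>)) borel (\<lambda>\<omega>. real (a\<^sub>s z 0 \<omega>))"
proof -
  let ?X = "case_sum (case_prod a\<^sub>c) (case_prod a\<^sub>s)"
  let ?i = "Inl (z, 0) :: int \<times> nat + int \<times> nat" and ?j = "Inr (z, 0) :: int \<times> nat + int \<times> nat"
  have "indep_var (PiM {?i} (\<lambda>_. count_space UNIV)) (\<lambda>\<omega>. restrict (\<lambda>i. ?X i \<omega>) {?i})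
                  (PiM {?j} (\<lambda>_. count_space UNIV)) (\<lambda>\<omega>. restrict (\<lambda>i. ?X i \<omega>) {?j})"
    by (rule indep_var_restrict[OF indep_arrivals]) auto
  then have "indep_var borel ((\<lambda>f. real (f ?i)) \<circ> (\<lambda>\<omega>. restrict (\<lambda>i. ?X i \<omega>) {?i}))
                       borel ((\<lambda>f. real (f ?j)) \<circ> (\<lambda>\<omega>. restrict (\<lambda>i. ?X i \<omega>) {?j}))"
    by (rule indep_var_compose) measurable
  then show ?thesis by (simp add: comp_def)
qed

lemma integrable_jump: "integrable M (jump z)"
  and jump_mean: "expectation (jump z) = rate_c z - rate_s z"
  using integrable_arrivals mean_c mean_s unfolding jump_def by simp_all

lemma integrable_jump_square: "integrable M (\<lambda>\<omega>. (jump z \<omega>)\<^sup>2)"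
  and jump_square_mean: "expectation (\<lambda>\<omega>. (jump z \<omega>)\<^sup>2) = jump_square z"
proof -
  let ?A = "\<lambda>\<omega>. real (a\<^sub>c z 0 \<omega>)" and ?S = "\<lambda>\<omega>. real (a\<^sub>s z 0 \<omega>)"
  note I = integrable_arrivals[of z]
  have AS: "integrable M (\<lambda>\<omega>. ?A \<omega> * ?S \<omega>)" "expectation (\<lambda>\<omega>. ?A \<omega> * ?S \<omega>) = rate_c z * rate_s z"
    using indep_var_integrable[OF indep_arrivals_pair I(1,3)]
      indep_var_lebesgue_integral[OF indep_arrivals_pair I(1,3)] by (simp_all add: mean_c mean_s)
  have eq: "(jump z \<omega>)\<^sup>2 = (?A \<omega>)\<^sup>2 + (?S \<omega>)\<^sup>2 - 2 * (?A \<omega> * ?S \<omega>)" for \<omega>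
    by (simp add: jump_def power2_diff)
  show "integrable M (\<lambda>\<omega>. (jump z \<omega>)\<^sup>2)"
    unfolding eq using I AS by simp
  have "expectation (\<lambda>\<omega>. (?A \<omega>)\<^sup>2) = \<sigma>\<^sub>c (rate_c z) + (rate_c z)\<^sup>2"
       "expectation (\<lambda>\<omega>. (?S \<omega>)\<^sup>2) = \<sigma>\<^sub>s (rate_s z) + (rate_s z)\<^sup>2"
    using variance_eq[OF I(1,2)] variance_eq[OF I(3,4)] var_c[of z] var_s[of z] by (simp_all add: mean_c mean_s)
  then show "expectation (\<lambda>\<omega>. (jump z \<omega>)\<^sup>2) = jump_square z"
    unfolding eq using I AS by (simp add: jump_square_def power2_diff)
qed

lemma integrable_jump_cube: "integrable M (\<lambda>\<omega>. \<bar>jump z \<omega>\<bar> ^ 3)"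
  and jump_cube_mean: "expectation (\<lambda>\<omega>. \<bar>jump z \<omega>\<bar> ^ 3) \<le> 2 * C"
proof -
  have le: "\<bar>jump z \<omega>\<bar> ^ 3 \<le> \<bar>real (a\<^sub>c z 0 \<omega>)\<bar> ^ 3 + \<bar>real (a\<^sub>s z 0 \<omega>)\<bar> ^ 3" for \<omega>
    unfolding jump_def by (rule cube_abs_diff_le) auto
  have int: "integrable M (\<lambda>\<omega>. \<bar>real (a\<^sub>c z 0 \<omega>)\<bar> ^ 3 + \<bar>real (a\<^sub>s z 0 \<omega>)\<bar> ^ 3)"
    using third_integrable_c third_integrable_s by simp
  show 1: "integrable M (\<lambda>\<omega>. \<bar>jump z \<omega>\<bar> ^ 3)"
    by (rule Bochner_Integration.integrable_bound[OF int]) (use le in auto)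
  have "expectation (\<lambda>\<omega>. \<bar>jump z \<omega>\<bar> ^ 3) \<le> expectation (\<lambda>\<omega>. \<bar>real (a\<^sub>c z 0 \<omega>)\<bar> ^ 3 + \<bar>real (a\<^sub>s z 0 \<omega>)\<bar> ^ 3)"
    by (rule integral_mono[OF 1 int le])
  also have "\<dots> \<le> 2 * C"
    using third_moment_c[of z] third_moment_s[of z] third_integrable_c third_integrable_s by simp
  finally show "expectation (\<lambda>\<omega>. \<bar>jump z \<omega>\<bar> ^ 3) \<le> 2 * C" .
qed

lemma jump_abs_mean: "expectation (\<lambda>\<omega>. \<bar>jump z \<omega>\<bar>) \<le> 1 + 2 * C"
  and jump_square_le: "\<bar>jump_square z\<bar> \<le> 1 + 2 * C"
proof -
  have "expectation (\<lambda>\<omega>. \<bar>jump z \<omega>\<bar>) \<le> expectation (\<lambda>\<omega>. 1 + \<bar>jump z \<omega>\<bar> ^ 3)"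
    using integrable_jump integrable_jump_cube by (intro integral_mono) (auto simp: abs_le_one_plus_cube)
  then show "expectation (\<lambda>\<omega>. \<bar>jump z \<omega>\<bar>) \<le> 1 + 2 * C"
    using jump_cube_mean[of z] integrable_jump_cube by (simp add: prob_space)
  have "jump_square z \<ge> 0"
    unfolding jump_square_mean[symmetric] by simp
  moreover have "expectation (\<lambda>\<omega>. (jump z \<omega>)\<^sup>2) \<le> expectation (\<lambda>\<omega>. 1 + \<bar>jump z \<omega>\<bar> ^ 3)"
    using integrable_jump_square integrable_jump_cube
    by (intro integral_mono) (auto simp: square_le_one_plus_cube)
  ultimately show "\<bar>jump_square z\<bar> \<le> 1 + 2 * C"
    using jump_cube_mean[of z] integrable_jump_cube by (simp add: prob_space jump_square_mean)
qed

text \<open>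
  The stationary identity for \<open>f (e z)\<close>, expanded to second order. The Taylor remainder is at most
  \<open>L / 2 * \<bar>e * jump\<bar> ^ 3\<close>, whose expectation is controlled by the third moments.
\<close>

lemma stationary_generator_bound:
  fixes f g h :: "real \<Rightarrow> real"
  assumes stat: "stationary_distribution M a\<^sub>c a\<^sub>s \<nu>" and e: "e > 0"
    and f: "\<And>x. (f has_real_derivative g x) (at x)"
    and g: "\<And>x. (g has_real_derivative h x) (at x)" "\<And>x. \<bar>g x\<bar> \<le> G"
    and h: "\<And>x y. \<bar>h x - h y\<bar> \<le> L * \<bar>x - y\<bar>"
  shows "\<bar>\<integral>z. e * (rate_c z - rate_s z) * g (e * z) + e\<^sup>2 / 2 * jump_square z * h (e * z) \<partial>\<nu>\<bar> \<le> L * C * e ^ 3"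
proof -
  interpret \<nu>: prob_space \<nu> using stat by (simp add: stationary_distribution_def)
  have sets[simp, measurable_cong]: "sets \<nu> = sets (count_space UNIV)"
    using stat by (simp add: stationary_distribution_def)
  define P where "P z = expectation (\<lambda>\<omega>. f (e * imbalance a\<^sub>c a\<^sub>s z 1 \<omega>) - f (e * z))" for z :: int
  define Q where "Q z = e * (rate_c z - rate_s z) * g (e * z) + e\<^sup>2 / 2 * jump_square z * h (e * z)" for z :: int
  have L: "L \<ge> 0" using h[of 1 0] by simp
  have cf: "continuous_on UNIV f"
    using f by (meson DERIV_isCont continuous_at_imp_continuous_on)
  have lip: "\<bar>f x - f y\<bar> \<le> G * \<bar>x - y\<bar>" for x y
    using field_differentiable_bound[of UNIV f g G x y] f g(2) by (auto simp: real_norm_def)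
  have [measurable]: "f \<in> borel_measurable borel"
    by (rule borel_measurable_continuous_onI[OF cf])
  have stationary: "(\<integral>z. P z \<partial>\<nu>) = 0"
    unfolding P_def
  proof (rule stationary_expectation_lipschitz[OF prob_space_axioms imbalance_one_measurable stat])
    show "\<bar>f (e * real_of_int x) - f (e * real_of_int y)\<bar> \<le> (G * e) * \<bar>real_of_int x - real_of_int y\<bar>" for x y
    proof -
      have "e * real_of_int x - e * real_of_int y = e * (real_of_int x - real_of_int y)"
        by (simp add: right_diff_distrib)
      then show ?thesis
        using lip[of "e * x" "e * y"] e by (simp add: abs_mult mult.assoc)
    qed
    show "integrable M (\<lambda>\<omega>. \<bar>real_of_int (imbalance a\<^sub>c a\<^sub>s x 1 \<omega>) - real_of_int x\<bar>)" for x
      unfolding imbalance_one using integrable_jump by simp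
    show "expectation (\<lambda>\<omega>. \<bar>real_of_int (imbalance a\<^sub>c a\<^sub>s x 1 \<omega>) - real_of_int x\<bar>) \<le> 1 + 2 * C" for x
      unfolding imbalance_one using jump_abs_mean by simp
  qed
  have diff: "\<bar>P z - Q z\<bar> \<le> L * C * e ^ 3"
    and Pb: "\<bar>P z\<bar> \<le> G * e * (1 + 2 * C)" for z
  proof -
    have P: "P z = expectation (\<lambda>\<omega>. f (e * z + e * jump z \<omega>) - f (e * z))"
      unfolding P_def imbalance_one by (simp add: algebra_simps)
    have le: "\<bar>f (e * z + e * jump z \<omega>) - f (e * z)\<bar> \<le> G * e * \<bar>jump z \<omega>\<bar>" for \<omega>
      using lip[of "e * z + e * jump z \<omega>" "e * z"] e by (simp add: abs_mult algebra_simps)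
    have iP: "integrable M (\<lambda>\<omega>. f (e * z + e * jump z \<omega>) - f (e * z))"
      by (rule Bochner_Integration.integrable_bound[where f="\<lambda>\<omega>. G * e * \<bar>jump z \<omega>\<bar>"])
         (use le integrable_jump in \<open>auto intro: order_trans[OF _ abs_ge_self]\<close>)
    have G: "G \<ge> 0" using g(2)[of 0] by linarith
    have "\<bar>P z\<bar> \<le> expectation (\<lambda>\<omega>. G * e * \<bar>jump z \<omega>\<bar>)"
      unfolding P using le iP integrable_jump by (intro abs_integral_le_integral) auto
    also have "\<dots> \<le> G * e * (1 + 2 * C)"
      using jump_abs_mean[of z] G e by (simp add: mult_left_mono)
    finally show "\<bar>P z\<bar> \<le> G * e * (1 + 2 * C)" .
    have iQ: "integrable M (\<lambda>\<omega>. e * jump z \<omega> * g (e * z) + (e * jump z \<omega>)\<^sup>2 / 2 * h (e * z))"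
      using integrable_jump integrable_jump_square by (simp add: power_mult_distrib)
    have Q: "Q z = expectation (\<lambda>\<omega>. e * jump z \<omega> * g (e * z) + (e * jump z \<omega>)\<^sup>2 / 2 * h (e * z))"
      using integrable_jump[of z] integrable_jump_square[of z]
      by (simp add: Q_def power_mult_distrib jump_mean jump_square_mean)
    have eq: "P z - Q z = expectation (\<lambda>\<omega>. f (e * z + e * jump z \<omega>) - f (e * z) -
        (e * jump z \<omega> * g (e * z) + (e * jump z \<omega>)\<^sup>2 / 2 * h (e * z)))"
      unfolding P Q using iP iQ by simp
    have "\<bar>P z - Q z\<bar> \<le> expectation (\<lambda>\<omega>. L / 2 * \<bar>e * jump z \<omega>\<bar> ^ 3)"
      unfolding eq
    proof (rule abs_integral_le_integral)
      show "integrable M (\<lambda>\<omega>. L / 2 * \<bar>e * jump z \<omega>\<bar> ^ 3)"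
        using integrable_jump_cube by (simp add: abs_mult power_mult_distrib)
      show "integrable M (\<lambda>\<omega>. f (e * z + e * jump z \<omega>) - f (e * z) -
          (e * jump z \<omega> * g (e * z) + (e * jump z \<omega>)\<^sup>2 / 2 * h (e * z)))"
        using iP iQ by (rule Bochner_Integration.integrable_diff)
      show "\<bar>f (e * z + e * jump z \<omega>) - f (e * z) -
          (e * jump z \<omega> * g (e * z) + (e * jump z \<omega>)\<^sup>2 / 2 * h (e * z))\<bar> \<le> L / 2 * \<bar>e * jump z \<omega>\<bar> ^ 3" for \<omega>
        by (rule second_order_taylor_lipschitz[OF f g(1) h])
    qed
    also have "\<dots> = expectation (\<lambda>\<omega>. (L / 2 * e ^ 3) * \<bar>jump z \<omega>\<bar> ^ 3)"
      using e by (intro Bochner_Integration.integral_cong) (simp_all add: abs_mult power_mult_distrib)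
    also have "\<dots> = (L / 2 * e ^ 3) * expectation (\<lambda>\<omega>. \<bar>jump z \<omega>\<bar> ^ 3)"
      by (rule integral_mult_right_zero)
    also have "\<dots> \<le> (L / 2 * e ^ 3) * (2 * C)"
      using L e by (intro mult_left_mono jump_cube_mean) simp
    finally show "\<bar>P z - Q z\<bar> \<le> L * C * e ^ 3" by (simp add: mult_ac)
  qed
  have iP: "integrable \<nu> P"
    by (rule \<nu>.integrable_const_bound[where B="G * e * (1 + 2 * C)"]) (simp_all add: Pb)
  have iD: "integrable \<nu> (\<lambda>z. P z - Q z)"
    by (rule \<nu>.integrable_const_bound[where B="L * C * e ^ 3"]) (simp_all add: diff)
  have iQ: "integrable \<nu> Q"
    using Bochner_Integration.integrable_diff[OF iP iD] by simp
  have "(\<integral>z. P z - Q z \<partial>\<nu>) = - (\<integral>z. Q z \<partial>\<nu>)"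
    unfolding Bochner_Integration.integral_diff[OF iP iQ] stationary by simp
  moreover have "\<bar>\<integral>z. P z - Q z \<partial>\<nu>\<bar> \<le> (\<integral>z. L * C * e ^ 3 \<partial>\<nu>)"
    by (rule abs_integral_le_integral[OF iD _ diff]) simp
  ultimately have "\<bar>\<integral>z. Q z \<partial>\<nu>\<bar> \<le> L * C * e ^ 3"
    by (simp add: \<nu>.prob_space)
  then show ?thesis unfolding Q_def .
qed

end

context matching_arrivals
begin

text \<open>
  Jumps are integer valued, so a positive jump has square at least 1.
\<close>

lemma jump_square_ge_prob: "measure M {\<omega> \<in> space M. a\<^sub>c z 0 \<omega> > a\<^sub>s z 0 \<omega>} \<le> jump_square z"
proof -
  have ev: "{\<omega> \<in> space M. a\<^sub>c z 0 \<omega> > a\<^sub>s z 0 \<omega>} \<in> events"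
  proof -
    have "{\<omega> \<in> space M. a\<^sub>c z 0 \<omega> > a\<^sub>s z 0 \<omega>} = {\<omega> \<in> space M. jump z \<omega> > 0}"
      by (auto simp: jump_def)
    also have "\<dots> \<in> events" by measurable
    finally show ?thesis .
  qed
  have "measure M {\<omega> \<in> space M. a\<^sub>c z 0 \<omega> > a\<^sub>s z 0 \<omega>}
      = expectation (\<lambda>\<omega>. indicator {\<omega> \<in> space M. a\<^sub>c z 0 \<omega> > a\<^sub>s z 0 \<omega>} \<omega>)"
    using ev by simp
  also have "\<dots> \<le> expectation (\<lambda>\<omega>. (jump z \<omega>)\<^sup>2)"
  proof (rule integral_mono)
    show "integrable M (\<lambda>\<omega>. indicator {\<omega> \<in> space M. a\<^sub>c z 0 \<omega> > a\<^sub>s z 0 \<omega>} \<omega> :: real)"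
      using ev by (simp add: emeasure_eq_measure)
    show "indicator {\<omega> \<in> space M. a\<^sub>c z 0 \<omega> > a\<^sub>s z 0 \<omega>} \<omega> \<le> (jump z \<omega>)\<^sup>2" for \<omega>
      using power_mono[of 1 "jump z \<omega>" 2] by (auto simp: indicator_def jump_def)
  qed (rule integrable_jump_square)
  finally show ?thesis by (simp add: jump_square_mean)
qed

text \<open>
  The form in which the queue meets the diffusion: dividing the generator bound by \<open>e\<^sup>2\<close> and
  replacing the second moment of the jumps by its limit \<open>s\<close> leaves an error that vanishes with \<open>e\<close>
  and \<open>d\<close>. The function to which the generator is applied is an antiderivative of \<open>g\<close>.
\<close>

lemma stationary_generator_approx:
  fixes g h \<psi> :: "real \<Rightarrow> real" and e :: real
  assumes stat: "stationary_distribution M a\<^sub>c a\<^sub>s \<nu>" and e: "e > 0"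
    and drift: "\<And>z. rate_c z - rate_s z = e * \<psi> (e * z)" "\<And>x. \<bar>\<psi> x\<bar> \<le> \<Phi>"
    and diffusion: "\<And>z. \<bar>jump_square z - s\<bar> \<le> d"
    and g: "\<And>x. (g has_real_derivative h x) (at x)" "\<And>x. \<bar>g x\<bar> \<le> G"
    and h: "\<And>x. \<bar>h x\<bar> \<le> H" "\<And>x y. \<bar>h x - h y\<bar> \<le> L * \<bar>x - y\<bar>"
  shows "\<bar>\<integral>z. \<psi> (e * z) * g (e * z) + s / 2 * h (e * z) \<partial>\<nu>\<bar> \<le> L * C * e + d * H / 2"
proof -
  interpret \<nu>: prob_space \<nu> using stat by (simp add: stationary_distribution_def)
  have sets[simp, measurable_cong]: "sets \<nu> = sets (count_space UNIV)"
    using stat by (simp add: stationary_distribution_def)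
  have "\<And>x. isCont g x" using g(1) by (rule DERIV_isCont)
  then obtain f where "\<And>x. (f has_vector_derivative g x) (at x)"
    using einterval_antiderivative[of "-\<infinity>" \<infinity> g] by auto
  then have f: "\<And>x. (f has_real_derivative g x) (at x)"
    by (simp add: has_real_derivative_iff_has_vector_derivative)
  define Q where "Q z = \<psi> (e * z) * g (e * z) + jump_square z / 2 * h (e * z)" for z :: int
  define R where "R z = (jump_square z - s) / 2 * h (e * z)" for z :: int
  have d: "d \<ge> 0" using diffusion[of 0] by linarith
  have "\<Phi> \<ge> 0" using drift(2)[of 0] by linarith
  then have b: "\<bar>\<psi> (e * z) * g (e * z)\<bar> \<le> \<Phi> * G" for z :: int
    unfolding abs_mult using drift(2) g(2) by (intro mult_mono) auto
  have R: "\<bar>R z\<bar> \<le> d * H / 2" for z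
  proof -
    have "\<bar>jump_square z - s\<bar> * \<bar>h (e * z)\<bar> \<le> d * H"
      using diffusion h(1) d by (intro mult_mono) auto
    then show ?thesis by (simp add: R_def abs_mult)
  qed
  have "\<bar>jump_square z / 2 * h (e * z)\<bar> \<le> (1 + 2 * C) / 2 * H" for z :: int
    unfolding abs_mult using jump_square_le[of z] h(1)[of "e * z"] by (intro mult_mono) auto
  then have Q: "\<bar>Q z\<bar> \<le> \<Phi> * G + (1 + 2 * C) / 2 * H" for z
    unfolding Q_def using b[of z] by (meson abs_triangle_ineq add_mono order_trans)
  have iQ: "integrable \<nu> Q"
    by (rule \<nu>.integrable_const_bound, rule AE_I2, unfold real_norm_def, rule Q) simp
  have iR: "integrable \<nu> R"
    by (rule \<nu>.integrable_const_bound, rule AE_I2, unfold real_norm_def, rule R) simp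
  have "(\<integral>z. e * (rate_c z - rate_s z) * g (e * z) + e\<^sup>2 / 2 * jump_square z * h (e * z) \<partial>\<nu>) = (\<integral>z. e\<^sup>2 * Q z \<partial>\<nu>)"
    unfolding drift(1) Q_def
    by (intro Bochner_Integration.integral_cong) (simp_all add: power2_eq_square algebra_simps)
  then have "\<bar>e\<^sup>2 * (\<integral>z. Q z \<partial>\<nu>)\<bar> \<le> L * C * e ^ 3"
    using stationary_generator_bound[OF stat e f g h(2)] by simp
  then have "e\<^sup>2 * \<bar>\<integral>z. Q z \<partial>\<nu>\<bar> \<le> e\<^sup>2 * (L * C * e)"
    by (simp add: abs_mult power2_eq_square power3_eq_cube mult_ac)
  then have "\<bar>\<integral>z. Q z \<partial>\<nu>\<bar> \<le> L * C * e"
    by (rule mult_left_le_imp_le) (use e in simp)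
  moreover have "\<bar>\<integral>z. R z \<partial>\<nu>\<bar> \<le> (\<integral>z. d * H / 2 \<partial>\<nu>)"
    by (rule abs_integral_le_integral[OF iR _ R]) simp
  moreover have "(\<integral>z. \<psi> (e * z) * g (e * z) + s / 2 * h (e * z) \<partial>\<nu>) = (\<integral>z. Q z - R z \<partial>\<nu>)"
    unfolding Q_def R_def by (intro Bochner_Integration.integral_cong) (simp_all add: algebra_simps diff_divide_distrib)
  ultimately show ?thesis
    unfolding Bochner_Integration.integral_diff[OF iQ iR] by (simp add: \<nu>.prob_space)
qed

end

section \<open>Test functions\<close>

lemma lipschitz_if_derivative_bounded:
  fixes f g :: "real \<Rightarrow> real"
  assumes "\<And>x. (f has_real_derivative g x) (at x)" "\<And>x. \<bar>g x\<bar> \<le> G"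
  shows "\<bar>f x - f y\<bar> \<le> G * \<bar>x - y\<bar>"
  using field_differentiable_bound[of UNIV f g G x y] assms by auto

text \<open>
  A smooth primitive of a smooth bump of width \<open>r\<close>: \<open>smooth_sign r\<close> is \<open>r\<close> times a smoothed sign
  function and its derivative \<open>peak r\<close> has height 1 at the origin. So the primitive is of size
  \<open>r\<close> while its derivative dominates a multiple of the indicator of \<open>{-r..r}\<close>; this is what
  turns the limiting equation into a bound on the mass near the origin.
\<close>

definition peak :: "real \<Rightarrow> real \<Rightarrow> real" where
  "peak r x = (r / sqrt (r\<^sup>2 + x\<^sup>2)) ^ 3"

definition smooth_sign :: "real \<Rightarrow> real \<Rightarrow> real" where
  "smooth_sign r x = r * x / sqrt (r\<^sup>2 + x\<^sup>2)"

context
  fixes r :: real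
  assumes r: "r > 0"
begin

lemma radius_bounds: "0 < sqrt (r\<^sup>2 + x\<^sup>2)" "r \<le> sqrt (r\<^sup>2 + x\<^sup>2)" "\<bar>x\<bar> \<le> sqrt (r\<^sup>2 + x\<^sup>2)"
proof -
  show "r \<le> sqrt (r\<^sup>2 + x\<^sup>2)" by (rule real_le_rsqrt) simp
  then show "0 < sqrt (r\<^sup>2 + x\<^sup>2)" using r by linarith
  show "\<bar>x\<bar> \<le> sqrt (r\<^sup>2 + x\<^sup>2)" by (rule real_le_rsqrt) simp
qed

lemma radius_derivative:
  "((\<lambda>x. sqrt (r\<^sup>2 + x\<^sup>2)) has_real_derivative x / sqrt (r\<^sup>2 + x\<^sup>2)) (at x)"
  using radius_bounds(1)[of x] r by (auto intro!: derivative_eq_intros simp: field_simps)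

lemma smooth_sign_derivative: "(smooth_sign r has_real_derivative peak r x) (at x)"
proof -
  let ?q = "sqrt (r\<^sup>2 + x\<^sup>2)"
  have "(smooth_sign r has_real_derivative (r * ?q - r * x * (x / ?q)) / (?q * ?q)) (at x)"
    unfolding smooth_sign_def using radius_bounds(1)[of x]
    by (intro DERIV_cong[OF DERIV_divide[OF DERIV_cmult[OF DERIV_ident] radius_derivative]]) auto
  moreover have "(r * ?q - r * x * (x / ?q)) / (?q * ?q) = r * (?q\<^sup>2 - x\<^sup>2) / ?q ^ 3"
  proof -
    have "(r * q - r * x * (x / q)) / (q * q) = r * (q\<^sup>2 - x\<^sup>2) / q ^ 3" if "q > 0" for q
      using that by (simp add: field_simps power2_eq_square power3_eq_cube)
    then show ?thesis using radius_bounds(1)[of x] .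
  qed
  moreover have "\<dots> = peak r x"
    by (simp add: peak_def power_divide power2_eq_square power3_eq_cube)
  ultimately show ?thesis by metis
qed

lemma peak_bounds: "0 \<le> peak r x" "peak r x \<le> 1"
  using radius_bounds[of x] r unfolding peak_def by (auto intro!: power_le_one)

lemma smooth_sign_bound: "\<bar>smooth_sign r x\<bar> \<le> r"
proof -
  have "\<bar>smooth_sign r x\<bar> = r * (\<bar>x\<bar> / sqrt (r\<^sup>2 + x\<^sup>2))"
    using r by (simp add: smooth_sign_def abs_mult)
  also have "\<dots> \<le> r * 1"
    using radius_bounds[of x] r by (intro mult_left_mono) auto
  finally show ?thesis by simp
qed

lemma peak_lipschitz: "\<bar>peak r x - peak r y\<bar> \<le> 3 / r * \<bar>x - y\<bar>"
proof (rule lipschitz_if_derivative_bounded)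
  fix x
  let ?q = "sqrt (r\<^sup>2 + x\<^sup>2)"
  note q = radius_bounds[of x]
  show "(peak r has_real_derivative - 3 / r * ((r / ?q) ^ 4 * (x / ?q))) (at x)"
    unfolding peak_def
    using q r
    by (intro DERIV_cong[OF DERIV_power[OF DERIV_divide[OF DERIV_const radius_derivative]]])
       (auto simp: power_divide divide_simps eval_nat_numeral simp del: real_sqrt_mult_self real_sqrt_mult power2_eq_square)
  have "\<bar>(r / ?q) ^ 4 * (x / ?q)\<bar> \<le> 1 * 1"
    unfolding abs_mult using q r by (intro mult_mono) (auto simp: power_le_one)
  then have "3 / r * \<bar>(r / ?q) ^ 4 * (x / ?q)\<bar> \<le> 3 / r * 1"
    using r by (intro mult_left_mono) auto
  then show "\<bar>- 3 / r * ((r / ?q) ^ 4 * (x / ?q))\<bar> \<le> 3 / r"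
    unfolding abs_mult[of "- 3 / r"] using r by simp
qed

lemma peak_ge: "\<bar>x\<bar> \<le> r \<Longrightarrow> 1 / 4 \<le> peak r x"
proof -
  assume x: "\<bar>x\<bar> \<le> r"
  have "x\<^sup>2 \<le> r\<^sup>2" using x r power_mono[of "\<bar>x\<bar>" r 2] by simp
  then have "sqrt (r\<^sup>2 + x\<^sup>2) \<le> sqrt (2 * r\<^sup>2)" by (intro real_sqrt_le_mono) simp
  also have "\<dots> = sqrt 2 * r" using r by (simp add: real_sqrt_mult)
  also have "\<dots> \<le> 3 / 2 * r" using r by (intro mult_right_mono real_le_lsqrt) (auto simp: power2_eq_square)
  finally have "2 / 3 \<le> r / sqrt (r\<^sup>2 + x\<^sup>2)"
    using radius_bounds[of x] by (simp add: field_simps)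
  then have "(2 / 3) ^ 3 \<le> peak r x" unfolding peak_def by (intro power_mono) auto
  then show ?thesis by (simp add: power3_eq_cube)
qed

lemma peak_zero [simp]: "peak r 0 = 1" "smooth_sign r 0 = 0"
  using r by (auto simp: peak_def smooth_sign_def)

end

lemma peak_measurable [measurable]: "peak r \<in> borel_measurable borel"
  and smooth_sign_measurable [measurable]: "smooth_sign r \<in> borel_measurable borel"
  unfolding peak_def smooth_sign_def by measurable

text \<open>
  If the derivative of \<open>g\<close> vanishes at 0, then freezing \<open>g\<close> to the left of 0 keeps it
  differentiable. Composing with \<open>max 0\<close>, which does not increase distances, also keeps any Lipschitz
  bound on the derivative.
\<close>

lemma freeze_below_zero_derivative:
  fixes g h :: "real \<Rightarrow> real"
  assumes g: "\<And>x. (g has_real_derivative h x) (at x)" and 0: "h 0 = 0"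
  shows "((\<lambda>x. g (max 0 x)) has_real_derivative h (max 0 x)) (at x)"
proof -
  consider "x > 0" | "x < 0" | "x = 0" by linarith
  then show ?thesis
  proof cases
    case 1
    then have "\<forall>\<^sub>F y in nhds x. g y = g (max 0 y)"
      using eventually_nhds_in_open[of "{0<..}" x] by (auto elim: eventually_mono)
    from DERIV_cong_ev[OF refl this refl, THEN iffD1, OF g] show ?thesis using 1 by simp
  next
    case 2
    then have "\<forall>\<^sub>F y in nhds x. g (max 0 y) = g 0"
      using eventually_nhds_in_open[of "{..<0}" x] by (auto elim: eventually_mono)
    from DERIV_cong_ev[OF refl this refl, THEN iffD2, OF DERIV_const] show ?thesis using 0 2 by simp
  next
    case 3
    have "((\<lambda>y. (g y - g 0) / (y - 0)) \<longlongrightarrow> 0) (at 0)"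
      using g[of 0] 0 by (simp add: has_field_derivative_iff)
    then have "((\<lambda>y. \<bar>(g y - g 0) / (y - 0)\<bar>) \<longlongrightarrow> 0) (at 0)"
      by (rule tendsto_rabs_zero)
    then have "((\<lambda>y. (g (max 0 y) - g (max 0 0)) / (y - 0)) \<longlongrightarrow> 0) (at 0)"
    proof (rule Lim_null_comparison[rotated], intro always_eventually allI)
      show "norm ((g (max 0 y) - g (max 0 0)) / (y - 0)) \<le> \<bar>(g y - g 0) / (y - 0)\<bar>" for y
        by (cases "0 \<le> y") (simp_all del: abs_divide add: max_def)
    qed
    then show ?thesis using 3 0 by (simp add: has_field_derivative_iff)
  qed
qed

section \<open>Limits of approximately stationary laws of a diffusion\<close>

text \<open>
  What is kept of the queue: random variables whose laws satisfy, in the limit, the stationary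
  equation of a diffusion with variance \<open>s\<close> and drift \<open>\<psi> n\<close>, where \<open>\<psi> n\<close> tends to \<open>-a\<close> on the
  right of 0 and to \<open>b\<close> on the left. The convergence of the drift is uniform only away from 0, and
  near 0 the drift is merely bounded. In the test class, \<open>g\<close> is the first and \<open>h\<close> the second
  derivative of the function to which the generator is applied.
\<close>

locale diffusion_limit =
  fixes N :: "nat \<Rightarrow> 'v measure" and X :: "nat \<Rightarrow> 'v \<Rightarrow> real" and \<psi> :: "nat \<Rightarrow> real \<Rightarrow> real"
    and s a b \<Phi> :: real
  assumes prob: "\<And>n. prob_space (N n)"
    and X_measurable [measurable]: "\<And>n. X n \<in> borel_measurable (N n)"
    and drift_measurable [measurable]: "\<And>n. \<psi> n \<in> borel_measurable borel"
    and drift_bound: "\<And>n x. \<bar>\<psi> n x\<bar> \<le> \<Phi>"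
    and pos: "s > 0" "a > 0" "b > 0"
    and drift_right: "\<And>r e. r > 0 \<Longrightarrow> e > 0 \<Longrightarrow> \<forall>\<^sub>F n in sequentially. \<forall>x\<ge>r. \<bar>\<psi> n x + a\<bar> \<le> e"
    and drift_left: "\<And>r e. r > 0 \<Longrightarrow> e > 0 \<Longrightarrow> \<forall>\<^sub>F n in sequentially. \<forall>x\<le>-r. \<bar>\<psi> n x - b\<bar> \<le> e"
    and generator: "\<And>g h G H L. (\<And>x. (g has_real_derivative h x) (at x)) \<Longrightarrow>
        (\<And>x. \<bar>g x\<bar> \<le> G) \<Longrightarrow> (\<And>x. \<bar>h x\<bar> \<le> H) \<Longrightarrow> (\<And>x y. \<bar>h x - h y\<bar> \<le> L * \<bar>x - y\<bar>) \<Longrightarrow>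
        (\<lambda>n. \<integral>\<omega>. \<psi> n (X n \<omega>) * g (X n \<omega>) + s / 2 * h (X n \<omega>) \<partial>N n) \<longlonglongrightarrow> 0"
begin

lemma drift_bound_nonneg: "\<Phi> \<ge> 0"
  using drift_bound[of 0 0] by linarith

lemma integrable_bounded:
  assumes "u \<in> borel_measurable (N n)" "\<And>x. \<bar>u x\<bar> \<le> U"
  shows "integrable (N n) (u :: 'v \<Rightarrow> real)"
  using assms prob[of n] by (intro finite_measure.integrable_const_bound[where B=U])
    (auto simp: prob_space.finite_measure)

lemma abs_expectation_le:
  assumes "u \<in> borel_measurable (N n)" "\<And>x. \<bar>u x\<bar> \<le> U"
  shows "\<bar>\<integral>\<omega>. u \<omega> \<partial>N n\<bar> \<le> (U :: real)"
proof -
  interpret prob_space "N n" by (rule prob)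
  have "\<bar>\<integral>\<omega>. u \<omega> \<partial>N n\<bar> \<le> (\<integral>\<omega>. U \<partial>N n)"
    using integrable_bounded[OF assms] assms(2) by (intro abs_integral_le_integral) auto
  then show ?thesis by (simp add: prob_space)
qed

text \<open>
  Reflection exchanges \<open>a\<close> and \<open>b\<close>, so all statements about the right half-line transfer to the left one.
\<close>

lemma reflected: "diffusion_limit N (\<lambda>n \<omega>. - X n \<omega>) (\<lambda>n x. - \<psi> n (- x)) s b a \<Phi>"
proof (rule diffusion_limit.intro)
  fix r e :: real assume re: "r > 0" "e > 0"
  show "\<forall>\<^sub>F n in sequentially. \<forall>x\<ge>r. \<bar>- \<psi> n (- x) + b\<bar> \<le> e"
    using drift_left[OF re]
  proof eventually_elim
    case (elim n)
    show ?case
    proof (intro allI impI)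
      fix x assume "r \<le> x"
      with elim have "\<bar>\<psi> n (- x) - b\<bar> \<le> e" by simp
      then show "\<bar>- \<psi> n (- x) + b\<bar> \<le> e" by linarith
    qed
  qed
  show "\<forall>\<^sub>F n in sequentially. \<forall>x\<le>-r. \<bar>- \<psi> n (- x) - a\<bar> \<le> e"
    using drift_right[OF re]
  proof eventually_elim
    case (elim n)
    show ?case
    proof (intro allI impI)
      fix x assume "x \<le> - r"
      with elim have "\<bar>\<psi> n (- x) + a\<bar> \<le> e" by simp
      then show "\<bar>- \<psi> n (- x) - a\<bar> \<le> e" by linarith
    qed
  qed
next
  fix g h :: "real \<Rightarrow> real" and G H L
  assume g: "\<And>x. (g has_real_derivative h x) (at x)" "\<And>x. \<bar>g x\<bar> \<le> G"
    and h: "\<And>x. \<bar>h x\<bar> \<le> H" "\<And>x y. \<bar>h x - h y\<bar> \<le> L * \<bar>x - y\<bar>"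
  have "(\<lambda>n. \<integral>\<omega>. \<psi> n (X n \<omega>) * - g (- X n \<omega>) + s / 2 * h (- X n \<omega>) \<partial>N n) \<longlonglongrightarrow> 0"
  proof (rule generator)
    show "((\<lambda>x. - g (- x)) has_real_derivative h (- x)) (at x)" for x
      using DERIV_minus[OF DERIV_mirror[THEN iffD1, OF g(1)[of "- x"]]] by simp
    show "\<bar>h (- x) - h (- y)\<bar> \<le> L * \<bar>x - y\<bar>" for x y
      using h(2)[of "- x" "- y"] by (simp add: abs_minus_commute)
  qed (use g h in auto)
  then show "(\<lambda>n. \<integral>\<omega>. - \<psi> n (- (- X n \<omega>)) * g (- X n \<omega>) + s / 2 * h (- X n \<omega>) \<partial>N n) \<longlonglongrightarrow> 0"
    by simp
next
  show "\<bar>- \<psi> n (- x)\<bar> \<le> \<Phi>" for n x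
    using drift_bound by simp
  show "(\<lambda>\<omega>. - X n \<omega>) \<in> borel_measurable (N n)" "(\<lambda>x. - \<psi> n (- x)) \<in> borel_measurable borel" for n
    by measurable
qed (fact prob pos)+

text \<open>
  The constant comes from bounding the drift term by \<open>\<Phi> * r\<close> and the vanishing error by \<open>r\<close>.
\<close>

definition "peak_const = 2 * (\<Phi> + 1) / s"

lemma peak_const_nonneg: "peak_const \<ge> 0"
  using pos drift_bound_nonneg by (simp add: peak_const_def)

text \<open>
  For \<open>g = smooth_sign r\<close> the drift term is at most \<open>\<Phi> * r\<close>, and the diffusion term
  must balance it. Hence no mass accumulates at the origin.
\<close>

lemma no_concentration_at_zero:
  assumes r: "r > 0"
  shows "\<forall>\<^sub>F n in sequentially. (\<integral>\<omega>. peak r (X n \<omega>) \<partial>N n) \<le> peak_const * r"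
proof -
  let ?I = "\<lambda>n. \<integral>\<omega>. \<psi> n (X n \<omega>) * smooth_sign r (X n \<omega>) + s / 2 * peak r (X n \<omega>) \<partial>N n"
  have "?I \<longlonglongrightarrow> 0"
    using peak_bounds[OF r]
    by (intro generator[OF smooth_sign_derivative[OF r] smooth_sign_bound[OF r] _ peak_lipschitz[OF r], of 1]) auto
  then have "\<forall>\<^sub>F n in sequentially. ?I n < r"
    using r by (rule order_tendstoD)
  then show ?thesis
  proof eventually_elim
    case (elim n)
    have psi: "\<bar>\<psi> n (X n \<omega>) * smooth_sign r (X n \<omega>)\<bar> \<le> \<Phi> * r" for \<omega>
      unfolding abs_mult using drift_bound smooth_sign_bound[OF r] drift_bound_nonneg by (intro mult_mono) auto
    have i1: "integrable (N n) (\<lambda>\<omega>. \<psi> n (X n \<omega>) * smooth_sign r (X n \<omega>))"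
      by (rule integrable_bounded[OF _ psi]) measurable
    have i2: "integrable (N n) (\<lambda>\<omega>. peak r (X n \<omega>))"
      using peak_bounds[OF r] by (intro integrable_bounded[where U=1]) auto
    have "- (\<Phi> * r) \<le> (\<integral>\<omega>. \<psi> n (X n \<omega>) * smooth_sign r (X n \<omega>) \<partial>N n)"
      using abs_expectation_le[OF borel_measurable_integrable[OF i1] psi] by linarith
    then have "s / 2 * (\<integral>\<omega>. peak r (X n \<omega>) \<partial>N n) \<le> (\<Phi> + 1) * r"
      using elim i1 i2 by (simp add: algebra_simps)
    then show ?case using pos by (simp add: peak_const_def field_simps)
  qed
qed

text \<open>
  A function supported on the right half-line and of linear growth at 0 does not see the
  uncontrolled drift near the origin: on \<open>{0<..<r}\<close> it is of order \<open>r\<close>, and on \<open>{r..}\<close> the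
  drift is close to \<open>-a\<close>.
\<close>

lemma one_sided_drift_limit:
  fixes u :: "real \<Rightarrow> real"
  assumes [measurable]: "u \<in> borel_measurable borel"
    and u: "\<And>x. \<bar>u x\<bar> \<le> U" "\<And>x. \<bar>u x\<bar> \<le> V * \<bar>x\<bar>" "\<And>x. x \<le> 0 \<Longrightarrow> u x = 0"
  shows "(\<lambda>n. \<integral>\<omega>. (\<psi> n (X n \<omega>) + a) * u (X n \<omega>) \<partial>N n) \<longlonglongrightarrow> 0"
proof (rule LIMSEQ_I, goal_cases)
  case (1 e)
  have U: "U \<ge> 0" and V: "V \<ge> 0" using u(1)[of 0] u(2)[of 1] by linarith+
  \<comment> \<open>Near 0 the integrand is at most \<open>(\<Phi> + a) * V * r\<close>, beyond \<open>r\<close> at most \<open>d * U\<close>; the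
      added 1 keeps the denominators positive.\<close>
  define r where "r = e / (4 * ((\<Phi> + a) * V + 1))"
  define d where "d = e / (4 * (U + 1))"
  have pa: "\<Phi> + a \<ge> 0" using drift_bound_nonneg pos by simp
  have pos': "(\<Phi> + a) * V + 1 > 0" using pa V by (simp add: add_nonneg_pos)
  have r: "r > 0" and d: "d > 0" using 1 pos' U by (auto simp: r_def d_def)
  have rV: "(\<Phi> + a) * (V * r) \<le> e / 4"
  proof -
    have "(\<Phi> + a) * (V * r) = (\<Phi> + a) * V * r" by simp
    also have "\<dots> \<le> ((\<Phi> + a) * V + 1) * r" using r by simp
    also have "\<dots> = e / 4" using pos' by (simp add: r_def field_simps)
    finally show ?thesis .
  qed
  have dU: "d * U \<le> e / 4"
  proof -
    have "d * U \<le> d * (U + 1)" using d by simp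
    also have "\<dots> = e / 4" using U by (simp add: d_def field_simps)
    finally show ?thesis .
  qed
  from drift_right[OF r d] have "\<forall>\<^sub>F n in sequentially. norm (\<integral>\<omega>. (\<psi> n (X n \<omega>) + a) * u (X n \<omega>) \<partial>N n) < e"
  proof eventually_elim
    case (elim n)
    have "\<bar>(\<psi> n x + a) * u x\<bar> \<le> e / 2" for x
    proof -
      consider "x \<le> 0" | "0 < x" "x < r" | "r \<le> x" by linarith
      then show ?thesis
      proof cases
        case 2
        have "\<bar>(\<psi> n x + a) * u x\<bar> \<le> (\<Phi> + a) * (V * r)"
          unfolding abs_mult
        proof (rule mult_mono)
          show "\<bar>\<psi> n x + a\<bar> \<le> \<Phi> + a" using drift_bound[of n x] pos by linarith
          have "V * \<bar>x\<bar> \<le> V * r" using 2 V by (intro mult_left_mono) auto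
          then show "\<bar>u x\<bar> \<le> V * r" using u(2)[of x] by linarith
        qed (use pa in auto)
        then show ?thesis using rV 1 by linarith
      next
        case 3
        have "\<bar>(\<psi> n x + a) * u x\<bar> \<le> d * U"
          unfolding abs_mult using elim 3 u(1) d by (intro mult_mono) auto
        then show ?thesis using dU 1 by linarith
      qed (use u 1 in auto)
    qed
    then have "\<bar>\<integral>\<omega>. (\<psi> n (X n \<omega>) + a) * u (X n \<omega>) \<partial>N n\<bar> \<le> e / 2"
      by (intro abs_expectation_le) auto
    then show ?case using 1 by simp
  qed
  then show ?case by (simp add: eventually_sequentially)
qed

text \<open>
  The limiting equation localised to the right half-line, where it has constant coefficients.
  Both \<open>g 0 = 0\<close> and \<open>h 0 = 0\<close> are needed for the cut-off function to be an admissible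
  test function.
\<close>

lemma one_sided_generator_limit:
  fixes g h :: "real \<Rightarrow> real"
  assumes g: "\<And>x. (g has_real_derivative h x) (at x)" "\<And>x. \<bar>g x\<bar> \<le> G"
    and h: "\<And>x. \<bar>h x\<bar> \<le> H" "\<And>x y. \<bar>h x - h y\<bar> \<le> L * \<bar>x - y\<bar>"
    and 0: "g 0 = 0" "h 0 = 0"
  shows "(\<lambda>n. \<integral>\<omega>. indicator {0..} (X n \<omega>) * (s / 2 * h (X n \<omega>) - a * g (X n \<omega>)) \<partial>N n) \<longlonglongrightarrow> 0"
proof -
  let ?g = "\<lambda>x. g (max 0 x)" and ?h = "\<lambda>x. h (max 0 x)"
  have cg: "continuous_on UNIV g"
    using g by (meson DERIV_isCont continuous_at_imp_continuous_on)
  have ch: "continuous_on UNIV h"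
  proof (rule lipschitz_on_continuous_on[of L])
    show "L-lipschitz_on UNIV h"
      using h(2) h(2)[of 1 0] by (intro lipschitz_onI) (auto simp: dist_real_def)
  qed
  have [measurable]: "g \<in> borel_measurable borel" "h \<in> borel_measurable borel"
    using cg ch by (auto intro: borel_measurable_continuous_onI)
  have L: "L \<ge> 0" using h(2)[of 1 0] by simp
  have H: "H \<ge> 0" using h(1)[of 0] by simp
  have lim1: "(\<lambda>n. \<integral>\<omega>. \<psi> n (X n \<omega>) * ?g (X n \<omega>) + s / 2 * ?h (X n \<omega>) \<partial>N n) \<longlonglongrightarrow> 0"
  proof (rule generator[OF freeze_below_zero_derivative])
    show "\<bar>?h x - ?h y\<bar> \<le> L * \<bar>x - y\<bar>" for x y
    proof (rule order_trans[OF h(2) mult_left_mono[OF _ L]])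
      show "\<bar>max 0 x - max 0 y\<bar> \<le> \<bar>x - y\<bar>" by (simp add: max_def)
    qed
  qed (use g h 0 in auto)
  have glin: "\<bar>?g x\<bar> \<le> H * \<bar>x\<bar>" for x
  proof (rule order_trans)
    show "\<bar>?g x\<bar> \<le> H * \<bar>max 0 x\<bar>"
      using lipschitz_if_derivative_bounded[OF g(1) h(1), of "max 0 x" 0] 0 by simp
    show "H * \<bar>max 0 x\<bar> \<le> H * \<bar>x\<bar>"
      using H by (intro mult_left_mono) (simp_all add: max_def)
  qed
  have lim2: "(\<lambda>n. \<integral>\<omega>. (\<psi> n (X n \<omega>) + a) * ?g (X n \<omega>) \<partial>N n) \<longlonglongrightarrow> 0"
    by (rule one_sided_drift_limit[of ?g G H]) (use g 0 glin in auto)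
  have "(\<integral>\<omega>. \<psi> n (X n \<omega>) * ?g (X n \<omega>) + s / 2 * ?h (X n \<omega>) \<partial>N n) - (\<integral>\<omega>. (\<psi> n (X n \<omega>) + a) * ?g (X n \<omega>) \<partial>N n)
      = (\<integral>\<omega>. indicator {0..} (X n \<omega>) * (s / 2 * h (X n \<omega>) - a * g (X n \<omega>)) \<partial>N n)" for n
  proof -
    have pg: "\<bar>\<psi> n x * ?g x\<bar> \<le> \<Phi> * G" for x
      unfolding abs_mult using drift_bound g(2) drift_bound_nonneg by (intro mult_mono) auto
    have i1: "integrable (N n) (\<lambda>\<omega>. \<psi> n (X n \<omega>) * ?g (X n \<omega>))"
      by (rule integrable_bounded[OF _ pg]) measurable
    have i2: "integrable (N n) (\<lambda>\<omega>. ?g (X n \<omega>))"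
      by (rule integrable_bounded[OF _ g(2)]) measurable
    have i3: "integrable (N n) (\<lambda>\<omega>. ?h (X n \<omega>))"
      by (rule integrable_bounded[OF _ h(1)]) measurable
    note i4 = Bochner_Integration.integrable_add[OF i1 integrable_mult_right[OF i3, of "s / 2"]]
    note i5 = Bochner_Integration.integrable_add[OF i1 integrable_mult_right[OF i2, of a]]
    have "(\<integral>\<omega>. \<psi> n (X n \<omega>) * ?g (X n \<omega>) + s / 2 * ?h (X n \<omega>) \<partial>N n) - (\<integral>\<omega>. (\<psi> n (X n \<omega>) + a) * ?g (X n \<omega>) \<partial>N n)
      = (\<integral>\<omega>. s / 2 * ?h (X n \<omega>) - a * ?g (X n \<omega>) \<partial>N n)"
      unfolding distrib_right Bochner_Integration.integral_diff[OF i4 i5, symmetric] by simp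
    also have "\<dots> = (\<integral>\<omega>. indicator {0..} (X n \<omega>) * (s / 2 * h (X n \<omega>) - a * g (X n \<omega>)) \<partial>N n)"
      using 0 by (intro Bochner_Integration.integral_cong) (simp_all add: indicator_def max_def)
    finally show ?thesis .
  qed
  with tendsto_diff[OF lim1 lim2] show ?thesis by (simp only: diff_self)
qed

text \<open>
  Real and imaginary part of the characteristic function restricted to the right half-line, and
  its value at 0.
\<close>

definition "right_cos t n = (\<integral>\<omega>. indicator {0..} (X n \<omega>) * cos (t * X n \<omega>) \<partial>N n)"
definition "right_sin t n = (\<integral>\<omega>. indicator {0..} (X n \<omega>) * sin (t * X n \<omega>) \<partial>N n)"
definition "right_mass n = measure (N n) {\<omega> \<in> space (N n). 0 \<le> X n \<omega>}"

lemma integrable_right [simp]: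
  "integrable (N n) (\<lambda>\<omega>. indicator {0..} (X n \<omega>) :: real)"
  "integrable (N n) (\<lambda>\<omega>. indicator {0..} (X n \<omega>) * cos (t * X n \<omega>))"
  "integrable (N n) (\<lambda>\<omega>. indicator {0..} (X n \<omega>) * sin (t * X n \<omega>))"
  by (rule integrable_bounded[where U=1]; simp add: indicator_def)+

lemma right_mass_eq: "right_mass n = (\<integral>\<omega>. indicator {0..} (X n \<omega>) \<partial>N n)"
proof -
  interpret prob_space "N n" by (rule prob)
  have "(\<integral>\<omega>. indicator {0..} (X n \<omega>) \<partial>N n)
      = (\<integral>\<omega>. (indicator {\<omega> \<in> space (N n). 0 \<le> X n \<omega>} \<omega> :: real) \<partial>N n)"
    by (intro Bochner_Integration.integral_cong) (auto simp: indicator_def)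
  then show ?thesis
    by (simp add: right_mass_def)
qed

text \<open>
  The test function \<open>cos (t x) - 1\<close> vanishes to second order at 0 and can be cut off as it stands.
\<close>

lemma right_cos_relation:
  "(\<lambda>n. a * right_cos t n + s * t / 2 * right_sin t n - a * right_mass n) \<longlonglongrightarrow> 0"
proof -
  have "(\<lambda>n. \<integral>\<omega>. indicator {0..} (X n \<omega>) * (s / 2 * (- t * sin (t * X n \<omega>)) - a * (cos (t * X n \<omega>) - 1)) \<partial>N n) \<longlonglongrightarrow> 0"
  proof (rule one_sided_generator_limit[where G=2 and H="\<bar>t\<bar>" and L="t\<^sup>2"])
    show "((\<lambda>x. cos (t * x) - 1) has_real_derivative - t * sin (t * x)) (at x)" for x
      by (auto intro!: derivative_eq_intros)
    show "\<bar>cos (t * x) - 1\<bar> \<le> 2" for x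
      using abs_cos_le_one[of "t * x"] by linarith
    show "\<bar>- t * sin (t * x)\<bar> \<le> \<bar>t\<bar>" for x
      by (simp add: abs_mult mult_left_le)
    show "\<bar>- t * sin (t * x) - - t * sin (t * y)\<bar> \<le> t\<^sup>2 * \<bar>x - y\<bar>" for x y
    proof (rule lipschitz_if_derivative_bounded)
      show "((\<lambda>x. - t * sin (t * x)) has_real_derivative - t * (cos (t * x) * t)) (at x)" for x
        by (auto intro!: derivative_eq_intros)
      show "\<bar>- t * (cos (t * x) * t)\<bar> \<le> t\<^sup>2" for x
        using abs_cos_le_one[of "t * x"] mult_left_mono[of "\<bar>cos (t * x)\<bar>" 1 "\<bar>t\<bar> * \<bar>t\<bar>"]
        by (simp add: abs_mult power2_eq_square mult_ac)
    qed
  qed simp_all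
  then have "(\<lambda>n. - (\<integral>\<omega>. indicator {0..} (X n \<omega>) * (s / 2 * (- t * sin (t * X n \<omega>)) - a * (cos (t * X n \<omega>) - 1)) \<partial>N n)) \<longlonglongrightarrow> 0"
    using tendsto_minus by fastforce
  moreover have "- (\<integral>\<omega>. indicator {0..} (X n \<omega>) * (s / 2 * (- t * sin (t * X n \<omega>)) - a * (cos (t * X n \<omega>) - 1)) \<partial>N n)
      = a * right_cos t n + s * t / 2 * right_sin t n - a * right_mass n" for n
  proof -
    have "(\<integral>\<omega>. indicator {0..} (X n \<omega>) * (s / 2 * (- t * sin (t * X n \<omega>)) - a * (cos (t * X n \<omega>) - 1)) \<partial>N n)
        = (\<integral>\<omega>. a * indicator {0..} (X n \<omega>) - (a * (indicator {0..} (X n \<omega>) * cos (t * X n \<omega>))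
             + s * t / 2 * (indicator {0..} (X n \<omega>) * sin (t * X n \<omega>))) \<partial>N n)"
      by (intro Bochner_Integration.integral_cong) (simp_all add: algebra_simps)
    also have "\<dots> = a * right_mass n - (a * right_cos t n + s * t / 2 * right_sin t n)"
      unfolding right_mass_eq right_cos_def right_sin_def
      by (subst Bochner_Integration.integral_diff, simp, simp, subst Bochner_Integration.integral_add) simp_all
    finally show ?thesis by simp
  qed
  ultimately show ?thesis by simp
qed

text \<open>
  The test function \<open>sin (t x)\<close> has slope \<open>t\<close> at 0, which would leave a jump in \<open>h\<close> after the
  cut-off. Subtracting \<open>t * smooth_sign r x\<close> removes the slope; by
  \<open>no_concentration_at_zero\<close> the correction costs only a multiple of \<open>r\<close>.
\<close>

lemma right_sin_relation:
  "(\<lambda>n. a * right_sin t n - s * t / 2 * right_cos t n) \<longlonglongrightarrow> 0"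
proof (rule LIMSEQ_I, goal_cases)
  case (1 e)
  \<comment> \<open>\<open>A * r\<close> bounds the two correction terms; the added 1 makes \<open>A\<close> positive.\<close>
  define A where "A = a * \<bar>t\<bar> + s / 2 * \<bar>t\<bar> * peak_const + 1"
  have A: "A > 0" using pos peak_const_nonneg by (simp add: A_def add_nonneg_pos)
  define r where "r = e / (2 * A)"
  have r: "r > 0" using 1 A by (simp add: r_def)
  let ?g = "\<lambda>x. sin (t * x) - t * smooth_sign r x" and ?h = "\<lambda>x. t * cos (t * x) - t * peak r x"
  let ?I = "\<lambda>n. \<integral>\<omega>. indicator {0..} (X n \<omega>) * (s / 2 * ?h (X n \<omega>) - a * ?g (X n \<omega>)) \<partial>N n"
  have "?I \<longlonglongrightarrow> 0"
  proof (rule one_sided_generator_limit)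
    show "(?g has_real_derivative ?h x) (at x)" for x
      by (auto intro!: derivative_eq_intros smooth_sign_derivative[OF r])
    show "\<bar>?g x\<bar> \<le> 1 + \<bar>t\<bar> * r" for x
    proof -
      have "\<bar>t * smooth_sign r x\<bar> \<le> \<bar>t\<bar> * r"
        unfolding abs_mult by (intro mult_left_mono smooth_sign_bound[OF r]) simp
      then show ?thesis using abs_sin_le_one[of "t * x"] by linarith
    qed
    show "\<bar>?h x\<bar> \<le> \<bar>t\<bar> + \<bar>t\<bar>" for x
    proof -
      have "\<bar>t * cos (t * x)\<bar> \<le> \<bar>t\<bar> * 1" "\<bar>t * peak r x\<bar> \<le> \<bar>t\<bar> * 1"
        unfolding abs_mult using peak_bounds[OF r, of x] by (intro mult_left_mono; simp)+
      then show ?thesis by linarith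
    qed
    show "\<bar>?h x - ?h y\<bar> \<le> (t\<^sup>2 + \<bar>t\<bar> * (3 / r)) * \<bar>x - y\<bar>" for x y
    proof -
      have "\<bar>t * cos (t * x) - t * cos (t * y)\<bar> \<le> t\<^sup>2 * \<bar>x - y\<bar>"
      proof (rule lipschitz_if_derivative_bounded)
        show "((\<lambda>x. t * cos (t * x)) has_real_derivative - (t * (sin (t * x) * t))) (at x)" for x
          by (auto intro!: derivative_eq_intros)
        show "\<bar>- (t * (sin (t * x) * t))\<bar> \<le> t\<^sup>2" for x
          using abs_sin_le_one[of "t * x"] mult_left_mono[of "\<bar>sin (t * x)\<bar>" 1 "\<bar>t\<bar> * \<bar>t\<bar>"]
          by (simp add: abs_mult power2_eq_square mult_ac)
      qed
      moreover have "\<bar>t * (peak r x - peak r y)\<bar> \<le> \<bar>t\<bar> * (3 / r * \<bar>x - y\<bar>)"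
        unfolding abs_mult by (intro mult_left_mono peak_lipschitz[OF r]) simp
      ultimately show ?thesis by (simp add: distrib_right right_diff_distrib)
    qed
  qed (use r in simp_all)
  then have "\<forall>\<^sub>F n in sequentially. \<bar>?I n\<bar> < e / 2"
    using 1 by (intro order_tendstoD(2)[of _ 0] tendsto_rabs_zero) auto
  with no_concentration_at_zero[OF r]
  have "\<forall>\<^sub>F n in sequentially. norm (a * right_sin t n - s * t / 2 * right_cos t n) < e"
  proof eventually_elim
    case (elim n)
    let ?i = "\<lambda>\<omega>. indicator {0..} (X n \<omega>) :: real"
    have b1: "\<bar>?i \<omega> * smooth_sign r (X n \<omega>)\<bar> \<le> r" for \<omega>
      using smooth_sign_bound[OF r, of "X n \<omega>"] r by (auto simp: indicator_def)
    have i1: "integrable (N n) (\<lambda>\<omega>. ?i \<omega> * smooth_sign r (X n \<omega>))"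
      by (rule integrable_bounded[OF _ b1]) measurable
    have b2: "\<bar>?i \<omega> * peak r (X n \<omega>)\<bar> \<le> peak r (X n \<omega>)" for \<omega>
      using peak_bounds[OF r, of "X n \<omega>"] by (auto simp: indicator_def)
    have b3: "\<bar>?i \<omega> * peak r (X n \<omega>)\<bar> \<le> 1" "\<bar>peak r (X n \<omega>)\<bar> \<le> 1" for \<omega>
      using b2[of \<omega>] peak_bounds[OF r, of "X n \<omega>"] by auto
    have i2: "integrable (N n) (\<lambda>\<omega>. ?i \<omega> * peak r (X n \<omega>))"
      by (rule integrable_bounded[OF _ b3(1)]) measurable
    have i3: "integrable (N n) (\<lambda>\<omega>. peak r (X n \<omega>))"
      by (rule integrable_bounded[OF _ b3(2)]) measurable
    let ?S = "\<integral>\<omega>. ?i \<omega> * smooth_sign r (X n \<omega>) \<partial>N n" and ?P = "\<integral>\<omega>. ?i \<omega> * peak r (X n \<omega>) \<partial>N n"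
    have S: "\<bar>?S\<bar> \<le> r"
      by (rule abs_expectation_le[OF borel_measurable_integrable[OF i1] b1])
    have P: "\<bar>?P\<bar> \<le> peak_const * r"
      using abs_integral_le_integral[OF i2 i3 b2] elim by linarith
    have "?I n = (\<integral>\<omega>. (s * t / 2 * (?i \<omega> * cos (t * X n \<omega>)) + a * t * (?i \<omega> * smooth_sign r (X n \<omega>)))
        - (a * (?i \<omega> * sin (t * X n \<omega>)) + s * t / 2 * (?i \<omega> * peak r (X n \<omega>))) \<partial>N n)"
      by (intro Bochner_Integration.integral_cong) (simp_all add: algebra_simps)
    also have "\<dots> = (s * t / 2 * right_cos t n + a * t * ?S) - (a * right_sin t n + s * t / 2 * ?P)"
      unfolding right_cos_def right_sin_def using i1 i2
      by (subst Bochner_Integration.integral_diff, simp, simp, (subst Bochner_Integration.integral_add, simp, simp)+) simp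
    finally have "a * right_sin t n - s * t / 2 * right_cos t n = a * t * ?S - s * t / 2 * ?P - ?I n"
      by linarith
    moreover have "\<bar>a * t * ?S\<bar> \<le> a * \<bar>t\<bar> * r"
      unfolding abs_mult using S pos by (intro mult_mono) auto
    moreover have "\<bar>s * t / 2 * ?P\<bar> \<le> s / 2 * \<bar>t\<bar> * (peak_const * r)"
      unfolding abs_mult using P pos by (intro mult_mono) (auto simp: abs_mult)
    moreover have "a * \<bar>t\<bar> * r + s / 2 * \<bar>t\<bar> * (peak_const * r) \<le> A * r"
      using r by (simp add: A_def algebra_simps)
    moreover have "A * r = e / 2" using A by (simp add: r_def)
    ultimately have "\<bar>a * right_sin t n - s * t / 2 * right_cos t n\<bar> < e"
      using elim by linarith
    then show ?case by simp
  qed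
  then show ?case by (simp add: eventually_sequentially)
qed

lemma atom_at_zero_vanishes:
  "(\<lambda>n. measure (N n) {\<omega> \<in> space (N n). X n \<omega> = 0}) \<longlonglongrightarrow> 0"
proof (rule LIMSEQ_I, goal_cases)
  case (1 e)
  define r where "r = e / (2 * (peak_const + 1))"
  have r: "r > 0" "peak_const * r < e"
  proof -
    show "r > 0" using 1 peak_const_nonneg by (simp add: r_def)
    then have "peak_const * r \<le> (peak_const + 1) * r" by simp
    also have "\<dots> = e / 2" using peak_const_nonneg by (simp add: r_def field_simps)
    finally show "peak_const * r < e" using 1 by linarith
  qed
  from no_concentration_at_zero[OF r(1)]
  have "\<forall>\<^sub>F n in sequentially. norm (measure (N n) {\<omega> \<in> space (N n). X n \<omega> = 0}) < e"
  proof eventually_elim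
    case (elim n)
    interpret prob_space "N n" by (rule prob)
    have "measure (N n) {\<omega> \<in> space (N n). X n \<omega> = 0}
        = (\<integral>\<omega>. (indicator {\<omega> \<in> space (N n). X n \<omega> = 0} \<omega> :: real) \<partial>N n)"
      by simp
    also have "\<dots> \<le> (\<integral>\<omega>. peak r (X n \<omega>) \<partial>N n)"
    proof (rule integral_mono)
      show "integrable (N n) (\<lambda>\<omega>. indicator {\<omega> \<in> space (N n). X n \<omega> = 0} \<omega> :: real)"
        by (rule integrable_bounded[where U=1]) (auto simp: indicator_def)
      show "integrable (N n) (\<lambda>\<omega>. peak r (X n \<omega>))"
        using peak_bounds[OF r(1)] by (intro integrable_bounded[where U=1]) auto
      show "indicator {\<omega> \<in> space (N n). X n \<omega> = 0} \<omega> \<le> peak r (X n \<omega>)" for \<omega>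
        using peak_bounds[OF r(1), of "X n \<omega>"] r(1) by (auto simp: indicator_def)
    qed
    finally show ?case using elim r(2) by simp
  qed
  then show ?case by (simp add: eventually_sequentially)
qed

interpretation reflected: diffusion_limit N "\<lambda>n \<omega>. - X n \<omega>" "\<lambda>n x. - \<psi> n (- x)" s b a \<Phi>
  by (rule reflected)

text \<open>
  The two closed half-lines overlap in the origin, whose mass vanishes.
\<close>

lemma mass_sum_limit: "(\<lambda>n. right_mass n + reflected.right_mass n) \<longlonglongrightarrow> 1"
proof -
  have "right_mass n + reflected.right_mass n = 1 + measure (N n) {\<omega> \<in> space (N n). X n \<omega> = 0}" for n
  proof -
    interpret prob_space "N n" by (rule prob)
    let ?R = "{\<omega> \<in> space (N n). 0 \<le> X n \<omega>}" and ?L = "{\<omega> \<in> space (N n). 0 \<le> - X n \<omega>}"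
    have "measure (N n) ?R + measure (N n) ?L = measure (N n) (?R \<union> ?L) + measure (N n) (?R \<inter> ?L)"
      by (subst measure_Un3) (auto simp: fmeasurable_def less_top[symmetric])
    moreover have "?R \<union> ?L = space (N n)" "?R \<inter> ?L = {\<omega> \<in> space (N n). X n \<omega> = 0}" by auto
    ultimately show ?thesis
      by (simp add: right_mass_def reflected.right_mass_def prob_space)
  qed
  then show ?thesis using tendsto_add[OF tendsto_const[of 1] atom_at_zero_vanishes] by simp
qed

text \<open>
  The constant test function \<open>g = 1\<close> says that the mean drift vanishes in the limit. Together
  with \<open>mass_sum_limit\<close> this fixes the masses of the two half-lines. The region near 0, where the
  drift is not close to its limits, contributes little by \<open>no_concentration_at_zero\<close>.
\<close>

lemma mass_balance: "(\<lambda>n. a * right_mass n - b * reflected.right_mass n) \<longlonglongrightarrow> 0"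
proof (rule LIMSEQ_I, goal_cases)
  case (1 e)
  \<comment> \<open>On \<open>{-r..r}\<close> the error is at most \<open>\<Phi> + a + b\<close> and \<open>peak r\<close> is at least 1/4.\<close>
  define A where "A = 4 * (\<Phi> + a + b)"
  have A: "A \<ge> 0" using drift_bound_nonneg pos by (simp add: A_def)
  define r where "r = e / (4 * (A * peak_const + 1))"
  have Ap: "A * peak_const + 1 > 0" using A peak_const_nonneg by (simp add: add_nonneg_pos)
  have r: "r > 0" using Ap 1 by (simp add: r_def)
  have Ar: "A * (peak_const * r) \<le> e / 4"
  proof -
    have "A * (peak_const * r) \<le> (A * peak_const + 1) * r" using r by (simp add: algebra_simps)
    also have "\<dots> = e / 4" using Ap by (simp add: r_def field_simps)
    finally show ?thesis .
  qed
  have e4: "e / 4 > 0" using 1 by simp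
  have "(\<lambda>n. \<integral>\<omega>. \<psi> n (X n \<omega>) * 1 + s / 2 * 0 \<partial>N n) \<longlonglongrightarrow> 0"
    by (rule generator[where G=1 and H=0 and L=0 and g="\<lambda>_. 1" and h="\<lambda>_. 0"]) auto
  then have "\<forall>\<^sub>F n in sequentially. \<bar>\<integral>\<omega>. \<psi> n (X n \<omega>) \<partial>N n\<bar> < e / 4"
    using e4 by (intro order_tendstoD(2)[of _ 0] tendsto_rabs_zero) auto
  with drift_right[OF r e4] drift_left[OF r e4] no_concentration_at_zero[OF r]
  have "\<forall>\<^sub>F n in sequentially. norm (a * right_mass n - b * reflected.right_mass n) < e"
  proof eventually_elim
    case (elim n)
    interpret prob_space "N n" by (rule prob)
    let ?R = "\<lambda>\<omega>. indicator {0..} (X n \<omega>) :: real" and ?L = "\<lambda>\<omega>. indicator {0..} (- X n \<omega>) :: real"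
    have i1: "integrable (N n) (\<lambda>\<omega>. \<psi> n (X n \<omega>))"
      by (rule integrable_bounded[OF _ drift_bound]) measurable
    have i2: "integrable (N n) (\<lambda>\<omega>. peak r (X n \<omega>))"
      using peak_bounds[OF r] by (intro integrable_bounded[where U=1]) auto
    have i3: "integrable (N n) (\<lambda>\<omega>. a * ?R \<omega> - b * ?L \<omega>)"
      by (intro Bochner_Integration.integrable_diff integrable_mult_right integrable_right reflected.integrable_right)
    note i4 = Bochner_Integration.integrable_add[OF i1 i3]
    have "\<bar>\<psi> n x + (a * indicator {0..} x - b * indicator {0..} (- x))\<bar> \<le> A * peak r x + e / 4" for x
    proof -
      consider "r \<le> x" | "x \<le> - r" | "\<bar>x\<bar> \<le> r" by linarith
      then show ?thesis
      proof cases
        case 1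
        then have "\<bar>\<psi> n x + a\<bar> \<le> e / 4" using elim by blast
        then show ?thesis using 1 r A peak_bounds[OF r, of x] by (simp add: indicator_def add_increasing)
      next
        case 2
        then have "\<bar>\<psi> n x - b\<bar> \<le> e / 4" using elim by blast
        then show ?thesis using 2 r A peak_bounds[OF r, of x] by (simp add: indicator_def add_increasing)
      next
        case 3
        have "\<bar>\<psi> n x + (a * indicator {0..} x - b * indicator {0..} (- x))\<bar> \<le> \<Phi> + a + b"
        proof -
          have "0 \<le> a * indicator {0..} x" "a * indicator {0..} x \<le> a"
            "0 \<le> b * indicator {0..} (- x)" "b * indicator {0..} (- x) \<le> b"
            using pos by (simp_all add: indicator_def)
          then show ?thesis using drift_bound[of n x] pos by linarith
        qed
        also have "\<dots> \<le> A * peak r x"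
          using mult_left_mono[OF peak_ge[OF r 3] A] by (simp add: A_def)
        finally show ?thesis using e4 by linarith
      qed
    qed
    then have "\<bar>\<integral>\<omega>. \<psi> n (X n \<omega>) + (a * ?R \<omega> - b * ?L \<omega>) \<partial>N n\<bar> \<le> (\<integral>\<omega>. A * peak r (X n \<omega>) + e / 4 \<partial>N n)"
      using i2 i4 by (intro abs_integral_le_integral) auto
    also have "\<dots> = A * (\<integral>\<omega>. peak r (X n \<omega>) \<partial>N n) + e / 4"
      using i2 by (simp add: prob_space)
    also have "\<dots> \<le> A * (peak_const * r) + e / 4"
      using elim A by (simp add: mult_left_mono)
    finally have "\<bar>\<integral>\<omega>. \<psi> n (X n \<omega>) + (a * ?R \<omega> - b * ?L \<omega>) \<partial>N n\<bar> \<le> e / 2"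
      using Ar by linarith
    moreover have "(\<integral>\<omega>. \<psi> n (X n \<omega>) + (a * ?R \<omega> - b * ?L \<omega>) \<partial>N n)
        = (\<integral>\<omega>. \<psi> n (X n \<omega>) \<partial>N n) + (a * right_mass n - b * reflected.right_mass n)"
      unfolding Bochner_Integration.integral_add[OF i1 i3] right_mass_eq reflected.right_mass_eq
      by (subst Bochner_Integration.integral_diff) simp_all
    ultimately have "\<bar>a * right_mass n - b * reflected.right_mass n\<bar> < e"
      using elim 1 by linarith
    then show ?case by simp
  qed
  then show ?case by (simp add: eventually_sequentially)
qed

lemma right_mass_limit: "right_mass \<longlonglongrightarrow> b / (a + b)"
proof -
  have "(\<lambda>n. ((a * right_mass n - b * reflected.right_mass n) + b * (right_mass n + reflected.right_mass n)) / (a + b))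
      \<longlonglongrightarrow> (0 + b * 1) / (a + b)"
    by (intro tendsto_intros mass_balance mass_sum_limit) (use pos in auto)
  moreover have "((a * right_mass n - b * reflected.right_mass n) + b * (right_mass n + reflected.right_mass n)) / (a + b)
      = right_mass n" for n
    using pos by (simp add: field_simps)
  ultimately show ?thesis by simp
qed

text \<open>
  The two relations are the real and imaginary part of
  \<open>(a - \<i> * s * t / 2) * u - a * right_mass \<longlonglongrightarrow> 0\<close> for \<open>u = right_cos + \<i> * right_sin\<close>, a linear
  system with determinant \<open>a\<^sup>2 + (s * t / 2)\<^sup>2 > 0\<close>. Its solution is the transform of an exponential
  law of rate \<open>2 * a / s\<close>.
\<close>

lemma right_cos_limit: "right_cos t \<longlonglongrightarrow> a\<^sup>2 / (a\<^sup>2 + (s * t / 2)\<^sup>2) * (b / (a + b))"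
  and right_sin_limit: "right_sin t \<longlonglongrightarrow> a * (s * t / 2) / (a\<^sup>2 + (s * t / 2)\<^sup>2) * (b / (a + b))"
proof -
  let ?c = "s * t / 2"
  let ?P = "\<lambda>n. a * right_cos t n + ?c * right_sin t n - a * right_mass n"
  let ?Q = "\<lambda>n. a * right_sin t n - ?c * right_cos t n"
  have pos': "a\<^sup>2 + ?c\<^sup>2 > 0" using pos by (simp add: add_pos_nonneg)
  have lim_eq: "(a * (0 + a * p) - c * 0) / D = a\<^sup>2 / D * p"
      "(c * (0 + a * p) + a * 0) / D = a * c / D * p" for c p D
    by (simp_all add: mult_ac power2_eq_square)
  have alg: "a * (a * x + c * y - m + m) - c * (a * y - c * x) = (a\<^sup>2 + c\<^sup>2) * x"
      "c * (a * x + c * y - m + m) + a * (a * y - c * x) = (a\<^sup>2 + c\<^sup>2) * y" for c x y m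
    by (simp_all add: algebra_simps power2_eq_square)
  have "(\<lambda>n. (a * (?P n + a * right_mass n) - ?c * ?Q n) / (a\<^sup>2 + ?c\<^sup>2))
      \<longlonglongrightarrow> (a * (0 + a * (b / (a + b))) - ?c * 0) / (a\<^sup>2 + ?c\<^sup>2)"
    by (intro tendsto_intros right_cos_relation right_sin_relation right_mass_limit) (use pos' in auto)
  moreover have "(a * (?P n + a * right_mass n) - ?c * ?Q n) / (a\<^sup>2 + ?c\<^sup>2) = right_cos t n" for n
    unfolding alg(1) using pos' by (intro nonzero_mult_div_cancel_left) linarith
  ultimately show "right_cos t \<longlonglongrightarrow> a\<^sup>2 / (a\<^sup>2 + ?c\<^sup>2) * (b / (a + b))"
    by (simp only: lim_eq)
  have "(\<lambda>n. (?c * (?P n + a * right_mass n) + a * ?Q n) / (a\<^sup>2 + ?c\<^sup>2))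
      \<longlonglongrightarrow> (?c * (0 + a * (b / (a + b))) + a * 0) / (a\<^sup>2 + ?c\<^sup>2)"
    by (intro tendsto_intros right_cos_relation right_sin_relation right_mass_limit) (use pos' in auto)
  moreover have "(?c * (?P n + a * right_mass n) + a * ?Q n) / (a\<^sup>2 + ?c\<^sup>2) = right_sin t n" for n
    unfolding alg(2) using pos' by (intro nonzero_mult_div_cancel_left) linarith
  ultimately show "right_sin t \<longlonglongrightarrow> a * ?c / (a\<^sup>2 + ?c\<^sup>2) * (b / (a + b))"
    by (simp only: lim_eq)
qed

end

lemma (in diffusion_limit) char_limit:
  "(\<lambda>n. char (distr (N n) borel (X n)) t) \<longlonglongrightarrow>
     of_real (b / (a + b)) * (of_real a / (of_real a - \<i> * of_real (s * t / 2)))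
     + of_real (a / (a + b)) * (of_real b / (of_real b + \<i> * of_real (s * t / 2)))"
proof -
  interpret reflected: diffusion_limit N "\<lambda>n \<omega>. - X n \<omega>" "\<lambda>n x. - \<psi> n (- x)" s b a \<Phi>
    by (rule reflected)
  let ?c = "s * t / 2"
  let ?atom = "\<lambda>n. measure (N n) {\<omega> \<in> space (N n). X n \<omega> = 0}"
  have cexp: "of_real a / (of_real a - \<i> * of_real c) = Complex (a\<^sup>2 / (a\<^sup>2 + c\<^sup>2)) (a * c / (a\<^sup>2 + c\<^sup>2))"
    if "a > 0" for a c :: real
  proof -
    have "a\<^sup>2 + c\<^sup>2 > 0" using that by (simp add: add_pos_nonneg)
    then show ?thesis using that
      by (simp add: complex_eq_iff Re_divide Im_divide power2_eq_square)
  qed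
  have "char (distr (N n) borel (X n)) t =
      Complex (right_cos t n + reflected.right_cos t n - ?atom n) (right_sin t n - reflected.right_sin t n)" for n
  proof -
    interpret prob_space "N n" by (rule prob)
    let ?R = "\<lambda>\<omega>. indicator {0..} (X n \<omega>) :: real" and ?L = "\<lambda>\<omega>. indicator {0..} (- X n \<omega>) :: real"
    let ?A = "\<lambda>\<omega>. indicator {\<omega> \<in> space (N n). X n \<omega> = 0} \<omega> :: real"
    have iA: "integrable (N n) ?A"
      by (rule integrable_bounded[where U=1]) (auto simp: indicator_def)
    have cis: "char (distr (N n) borel (X n)) t = (\<integral>\<omega>. iexp (t * X n \<omega>) \<partial>N n)"
      by (simp add: char_def integral_distr)
    have int: "integrable (N n) (\<lambda>\<omega>. iexp (t * X n \<omega>))"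
      by (rule integrable_const_bound[where B=1]) auto
    have "Re (char (distr (N n) borel (X n)) t) = (\<integral>\<omega>. Re (iexp (t * X n \<omega>)) \<partial>N n)"
      unfolding cis using int by (rule integral_Re[symmetric])
    also have "\<dots> = (\<integral>\<omega>. (?R \<omega> * cos (t * X n \<omega>) + ?L \<omega> * cos (t * (- X n \<omega>))) - ?A \<omega> \<partial>N n)"
      by (intro Bochner_Integration.integral_cong) (auto simp: indicator_def Re_exp)
    also have "\<dots> = right_cos t n + reflected.right_cos t n - ?atom n"
      unfolding right_cos_def reflected.right_cos_def
      using integrable_right(2)[of n t] reflected.integrable_right(2)[of n t] iA
      by (subst Bochner_Integration.integral_diff, simp, simp, subst Bochner_Integration.integral_add) simp_all
    finally have 1: "Re (char (distr (N n) borel (X n)) t) = right_cos t n + reflected.right_cos t n - ?atom n" .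
    have "Im (char (distr (N n) borel (X n)) t) = (\<integral>\<omega>. Im (iexp (t * X n \<omega>)) \<partial>N n)"
      unfolding cis using int by (rule integral_Im[symmetric])
    also have "\<dots> = (\<integral>\<omega>. ?R \<omega> * sin (t * X n \<omega>) - ?L \<omega> * sin (t * (- X n \<omega>)) \<partial>N n)"
      by (intro Bochner_Integration.integral_cong) (auto simp: indicator_def Im_exp)
    also have "\<dots> = right_sin t n - reflected.right_sin t n"
      unfolding right_sin_def reflected.right_sin_def
      using integrable_right(3)[of n t] reflected.integrable_right(3)[of n t]
      by (subst Bochner_Integration.integral_diff) simp_all
    finally show ?thesis using 1 by (simp add: complex_eq_iff)
  qed
  moreover have "(\<lambda>n. Complex (right_cos t n + reflected.right_cos t n - ?atom n) (right_sin t n - reflected.right_sin t n))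
      \<longlonglongrightarrow> Complex (a\<^sup>2 / (a\<^sup>2 + ?c\<^sup>2) * (b / (a + b)) + b\<^sup>2 / (b\<^sup>2 + ?c\<^sup>2) * (a / (b + a)) - 0)
        (a * ?c / (a\<^sup>2 + ?c\<^sup>2) * (b / (a + b)) - b * ?c / (b\<^sup>2 + ?c\<^sup>2) * (a / (b + a)))"
    by (intro tendsto_Complex tendsto_diff tendsto_add right_cos_limit reflected.right_cos_limit
        right_sin_limit reflected.right_sin_limit atom_at_zero_vanishes)
  moreover have "Complex (a\<^sup>2 / (a\<^sup>2 + ?c\<^sup>2) * (b / (a + b)) + b\<^sup>2 / (b\<^sup>2 + ?c\<^sup>2) * (a / (b + a)) - 0)
        (a * ?c / (a\<^sup>2 + ?c\<^sup>2) * (b / (a + b)) - b * ?c / (b\<^sup>2 + ?c\<^sup>2) * (a / (b + a)))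
      = of_real (b / (a + b)) * (of_real a / (of_real a - \<i> * of_real ?c))
        + of_real (a / (a + b)) * (of_real b / (of_real b + \<i> * of_real ?c))"
  proof -
    have b: "of_real b / (of_real b + \<i> * of_real c) = Complex (b\<^sup>2 / (b\<^sup>2 + c\<^sup>2)) (- (b * c / (b\<^sup>2 + c\<^sup>2)))" for c
      using cexp[OF pos(3), of "- c"] by simp
    show ?thesis
      unfolding b cexp[OF pos(2)] complex_eq_iff by (simp add: add.commute mult.commute)
  qed
  ultimately show ?thesis by simp
qed

text \<open>
  The parameters of the Laplace law are chosen such that \<open>l * \<kappa> = 2 * a / s\<close> and
  \<open>l / \<kappa> = 2 * b / s\<close>, the exponential rates on the two half-lines.
\<close>

lemma (in diffusion_limit) weak_limit:
  "weak_conv_m (\<lambda>n. distr (N n) borel (X n)) (asym_laplace 0 (2 * sqrt (a * b) / s) (sqrt (a / b)))"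
proof -
  define l where "l = 2 * sqrt (a * b) / s"
  define \<kappa> where "\<kappa> = sqrt (a / b)"
  have l: "l > 0" and \<kappa>: "\<kappa> > 0" using pos by (simp_all add: l_def \<kappa>_def)
  have "sqrt (a * b) * sqrt (a / b) = a"
    using pos by (simp flip: real_sqrt_mult)
  then have l_mult: "l * \<kappa> = 2 * a / s"
    by (simp add: l_def \<kappa>_def)
  have "sqrt (a * b) / sqrt (a / b) = b"
    using pos by (simp flip: real_sqrt_divide)
  moreover have "l / \<kappa> = 2 / s * (sqrt (a * b) / sqrt (a / b))"
    by (simp add: l_def \<kappa>_def)
  ultimately have l_div: "l / \<kappa> = 2 * b / s"
    by simp
  have "l / (\<kappa> + 1 / \<kappa>) = 1 / (1 / (l / \<kappa>) + 1 / (l * \<kappa>))"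
    using l \<kappa> by (simp add: field_simps)
  also have "\<dots> = 2 / s * (a * b / (a + b))"
    unfolding l_mult l_div using pos by (simp add: field_simps)
  finally have const: "l / (\<kappa> + 1 / \<kappa>) = 2 / s * (a * b / (a + b))" .
  have half: "of_real m * (of_real q / (of_real q - z * of_real (s * t / 2)))
      = of_real k * (1 / (of_real (2 * q / s) - z * of_real t))"
    if k: "k = 2 / s * (m * q)" for q t m k :: real and z :: complex
  proof -
    have "of_real (2 * q / s) - z * of_real t = of_real (2 / s) * (of_real q - z * of_real (s * t / 2))"
      using pos by (simp add: field_simps)
    then show ?thesis using pos unfolding k by (simp add: field_simps)
  qed
  have char: "char (asym_laplace 0 l \<kappa>) t =
      of_real (b / (a + b)) * (of_real a / (of_real a - \<i> * of_real (s * t / 2)))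
      + of_real (a / (a + b)) * (of_real b / (of_real b + \<i> * of_real (s * t / 2)))" for t
  proof -
    have "2 / s * (a * b / (a + b)) = 2 / s * (b / (a + b) * a)" "2 / s * (a * b / (a + b)) = 2 / s * (a / (a + b) * b)"
      by simp_all
    note eq1 = half[OF this(1), of \<i> t] and eq2 = half[OF this(2), of "- \<i>" t]
    show ?thesis
      unfolding char_asym_laplace[OF l \<kappa>] const l_mult l_div
      using eq1 eq2 by (simp only: mult_minus_left diff_minus_eq_add distrib_left)
  qed
  show ?thesis
    unfolding l_def[symmetric] \<kappa>_def[symmetric]
  proof (rule levy_continuity)
    show "real_distribution (distr (N n) borel (X n))" for n
      using prob[of n] by (intro prob_space.real_distribution_distr) auto
    show "real_distribution (asym_laplace 0 l \<kappa>)"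
      by (rule real_distribution_asym_laplace[OF l \<kappa>])
    show "(\<lambda>n. char (distr (N n) borel (X n)) t) \<longlonglongrightarrow> char (asym_laplace 0 l \<kappa>) t" for t
      unfolding char by (rule char_limit)
  qed
qed

section \<open>Control curves in the vanishing-scale regime\<close>

lemma clip_inactive: "x_min \<le> x \<Longrightarrow> x \<le> x_max \<Longrightarrow> clip x x_max x_min = x"
  by (simp add: clip_def)

lemma bounded_if_limits_and_powr_bound:
  fixes f :: "real \<Rightarrow> real"
  assumes top: "(f \<longlongrightarrow> u) at_top" and bot: "(f \<longlongrightarrow> v) at_bot"
    and growth: "\<And>x. \<bar>f x\<bar> \<le> \<bar>x\<bar> powr \<beta>" and "\<beta> > 0"
  obtains B where "\<And>x. \<bar>f x\<bar> \<le> B"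
proof -
  have "\<forall>\<^sub>F x in at_top. \<bar>f x\<bar> < \<bar>u\<bar> + 1"
    using tendsto_rabs[OF top] by (rule order_tendstoD) simp
  then obtain r where r: "\<And>x. x \<ge> r \<Longrightarrow> \<bar>f x\<bar> < \<bar>u\<bar> + 1"
    by (auto simp: eventually_at_top_linorder)
  have "\<forall>\<^sub>F x in at_bot. \<bar>f x\<bar> < \<bar>v\<bar> + 1"
    using tendsto_rabs[OF bot] by (rule order_tendstoD) simp
  then obtain r' where r': "\<And>x. x \<le> r' \<Longrightarrow> \<bar>f x\<bar> < \<bar>v\<bar> + 1"
    by (auto simp: eventually_at_bot_linorder)
  have "\<bar>f x\<bar> \<le> \<bar>u\<bar> + 1 + (\<bar>v\<bar> + 1) + max \<bar>r\<bar> \<bar>r'\<bar> powr \<beta>" for x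
  proof -
    have p: "0 \<le> max \<bar>r\<bar> \<bar>r'\<bar> powr \<beta>" by simp
    consider "x \<ge> r" | "x \<le> r'" | "\<bar>x\<bar> \<le> max \<bar>r\<bar> \<bar>r'\<bar>" by linarith
    then show ?thesis
    proof cases
      case 3
      then have "\<bar>x\<bar> powr \<beta> \<le> max \<bar>r\<bar> \<bar>r'\<bar> powr \<beta>"
        using assms(4) by (intro powr_mono2) auto
      then show ?thesis using growth[of x] by linarith
    qed (use r[of x] r'[of x] p in linarith)+
  qed
  then show ?thesis by (rule that)
qed

text \<open>
  As the scale \<open>w\<close> shrinks, \<open>x / w\<close> tends to infinity uniformly in \<open>x \<ge> r\<close>.
\<close>

lemma rescaled_limit_uniform:
  fixes f :: "real \<Rightarrow> real"
  assumes f: "(f \<longlongrightarrow> u) at_top" and w: "(w \<longlongrightarrow> 0) F" "\<forall>\<^sub>F i in F. w i > 0"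
    and "r > 0" "e > 0"
  shows "\<forall>\<^sub>F i in F. \<forall>x\<ge>r. \<bar>f (x / w i) - u\<bar> \<le> e"
proof -
  have "\<forall>\<^sub>F x in at_top. dist (f x) u < e"
    using f \<open>e > 0\<close> by (rule tendstoD)
  then obtain R where R: "\<And>x. x \<ge> R \<Longrightarrow> \<bar>f x - u\<bar> < e"
    by (auto simp: eventually_at_top_linorder dist_real_def)
  have "r / (\<bar>R\<bar> + 1) > 0" using \<open>r > 0\<close> by simp
  with w(1) have "\<forall>\<^sub>F i in F. w i < r / (\<bar>R\<bar> + 1)"
    by (rule order_tendstoD)
  with w(2) show ?thesis
  proof eventually_elim
    case (elim i)
    show ?case
    proof (intro allI impI)
      fix x assume "r \<le> x"
      have "R * w i \<le> (\<bar>R\<bar> + 1) * w i" using elim by (intro mult_right_mono) auto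
      also have "\<dots> \<le> r" using elim by (simp add: field_simps)
      finally have "R \<le> x / w i" using elim \<open>r \<le> x\<close> by (simp add: field_simps)
      then show "\<bar>f (x / w i) - u\<bar> \<le> e" using R by (simp add: less_imp_le)
    qed
  qed
qed

theorem theorem2:
  fixes lam_max lam_min mu_max mu_min \<sigma>_max C lam_star mu_star :: real
    and \<sigma>\<^sub>c \<sigma>\<^sub>s \<phi>\<^sub>c \<phi>\<^sub>s :: "real \<Rightarrow> real"
    and \<epsilon> \<tau> lam_star_at :: "real \<Rightarrow> real"
    and M :: "real \<Rightarrow> 'w measure"
    and a\<^sub>c a\<^sub>s :: "real \<Rightarrow> int \<Rightarrow> nat \<Rightarrow> 'w \<Rightarrow> nat"
    and N :: "real \<Rightarrow> 'v measure"
    and zbar :: "real \<Rightarrow> 'v \<Rightarrow> int"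
    and \<delta> K B \<beta> p_min \<eta>\<^sub>p :: real
  assumes lam_bounds: "0 \<le> lam_min" "lam_min \<le> lam_max"
    and mu_bounds: "0 \<le> mu_min" "mu_min \<le> mu_max"
    and constants: "\<sigma>_max > 0" "C > 0"
    and mu_star: "lam_min < mu_star" "mu_star < lam_max" "mu_min < mu_star" "mu_star < mu_max"
    and \<sigma>\<^sub>c: "continuous_on UNIV \<sigma>\<^sub>c" "\<And>x. \<sigma>\<^sub>c x \<in> {0..\<sigma>_max}"
    and \<sigma>\<^sub>s: "continuous_on UNIV \<sigma>\<^sub>s" "\<And>x. \<sigma>\<^sub>s x \<in> {0..\<sigma>_max}"
    and curves: "\<phi>\<^sub>c \<in> borel_measurable borel" "\<phi>\<^sub>s \<in> borel_measurable borel"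
    and scaling: "\<And>\<eta>. \<eta> > 0 \<Longrightarrow> \<epsilon> \<eta> > 0" "\<And>\<eta>. \<eta> > 0 \<Longrightarrow> \<tau> \<eta> > 0"
    and arrivals: "\<And>\<eta>. \<eta> > 0 \<Longrightarrow>
          matching_arrivals (M \<eta>) (a\<^sub>c \<eta>) (a\<^sub>s \<eta>)
            (controlled_rate (lam_star_at \<eta>) (\<epsilon> \<eta>) (\<tau> \<eta>) \<phi>\<^sub>c lam_max lam_min)
            (controlled_rate mu_star (\<epsilon> \<eta>) (\<tau> \<eta>) \<phi>\<^sub>s mu_max mu_min)
            \<sigma>\<^sub>c \<sigma>\<^sub>s C"
    and irreducible: "\<And>\<eta>. \<eta> > 0 \<Longrightarrow> irreducible_chain (M \<eta>) (a\<^sub>c \<eta>) (a\<^sub>s \<eta>)"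
    and aperiodic: "\<And>\<eta>. \<eta> > 0 \<Longrightarrow> aperiodic_chain (M \<eta>) (a\<^sub>c \<eta>) (a\<^sub>s \<eta>)"
    and regime: "(\<epsilon> \<longlongrightarrow> 0) at_top \<or> filterlim \<tau> at_top at_top"
    and vanishing: "((\<lambda>\<eta>. \<epsilon> \<eta> * \<tau> \<eta>) \<longlongrightarrow> 0) at_top"
    and balanced: "\<And>\<eta>. \<eta> > 0 \<Longrightarrow> lam_star_at \<eta> = lam_star" "lam_star = mu_star"
    and negative_drift_constants: "\<delta> > 0" "K > 0" "B > 0"
    and negative_drift_right: "\<And>x. x > K \<Longrightarrow>
          \<phi>\<^sub>c x - \<phi>\<^sub>s x < - \<delta> \<and> max (\<phi>\<^sub>c x) 0 + max (- \<phi>\<^sub>s x) 0 \<le> B"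
    and negative_drift_left: "\<And>x. x < - K \<Longrightarrow>
          \<phi>\<^sub>c x - \<phi>\<^sub>s x > \<delta> \<and> max (- \<phi>\<^sub>c x) 0 + max (\<phi>\<^sub>s x) 0 \<le> B"
    and sub_quadratic_exponent: "0 < \<beta>" "\<beta> < 2"
    and sub_quadratic_growth: "\<And>x. \<bar>\<phi>\<^sub>c x\<bar> \<le> \<bar>x\<bar> powr \<beta>" "\<And>x. \<bar>\<phi>\<^sub>s x\<bar> \<le> \<bar>x\<bar> powr \<beta>"
    and finite_limits:
          "\<exists>l. (\<phi>\<^sub>c \<longlongrightarrow> l) at_top" "\<exists>l. (\<phi>\<^sub>c \<longlongrightarrow> l) at_bot"
          "\<exists>l. (\<phi>\<^sub>s \<longlongrightarrow> l) at_top" "\<exists>l. (\<phi>\<^sub>s \<longlongrightarrow> l) at_bot"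
    and p_min: "p_min > 0"
    and jumps: "\<And>\<eta> z. \<eta> > 0 \<Longrightarrow> real_of_int \<bar>z\<bar> \<le> K * max (\<tau> \<eta>) (1 / \<epsilon> \<eta>) \<Longrightarrow>
          measure (M \<eta>) {\<omega> \<in> space (M \<eta>). a\<^sub>c \<eta> z 0 \<omega> > a\<^sub>s \<eta> z 0 \<omega>} \<ge> p_min \<and>
          measure (M \<eta>) {\<omega> \<in> space (M \<eta>). a\<^sub>c \<eta> z 0 \<omega> < a\<^sub>s \<eta> z 0 \<omega>} \<ge> p_min"
    and \<eta>\<^sub>p: "\<eta>\<^sub>p > 0"
    and positive_recurrent: "\<And>\<eta>. \<eta> > \<eta>\<^sub>p \<Longrightarrow> positive_recurrent_chain (M \<eta>) (a\<^sub>c \<eta>) (a\<^sub>s \<eta>)"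
    and steady_state_space: "\<And>\<eta>. \<eta> > \<eta>\<^sub>p \<Longrightarrow> prob_space (N \<eta>)"
    and steady_state_var: "\<And>\<eta>. \<eta> > \<eta>\<^sub>p \<Longrightarrow> zbar \<eta> \<in> measurable (N \<eta>) (count_space UNIV)"
    and steady_state: "\<And>\<eta>. \<eta> > \<eta>\<^sub>p \<Longrightarrow>
          stationary_distribution (M \<eta>) (a\<^sub>c \<eta>) (a\<^sub>s \<eta>)
            (distr (N \<eta>) (count_space UNIV) (zbar \<eta>))"
  shows "weak_conv_along
           (\<lambda>\<eta>. distr (N \<eta>) borel (\<lambda>\<omega>. \<epsilon> \<eta> * real_of_int (zbar \<eta> \<omega>)))
           (asym_laplace 0
              (2 * sqrt \<bar>limit_gap \<phi>\<^sub>c \<phi>\<^sub>s 1 * limit_gap \<phi>\<^sub>c \<phi>\<^sub>s (- 1)\<bar> / (\<sigma>\<^sub>c lam_star + \<sigma>\<^sub>s mu_star))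
              (sqrt (\<bar>limit_gap \<phi>\<^sub>c \<phi>\<^sub>s 1\<bar> / \<bar>limit_gap \<phi>\<^sub>c \<phi>\<^sub>s (- 1)\<bar>)))
           at_top"
proof -
  obtain cp cm sp sm where lims: "(\<phi>\<^sub>c \<longlongrightarrow> cp) at_top" "(\<phi>\<^sub>c \<longlongrightarrow> cm) at_bot"
      "(\<phi>\<^sub>s \<longlongrightarrow> sp) at_top" "(\<phi>\<^sub>s \<longlongrightarrow> sm) at_bot"
    using finite_limits by blast
  define a where "a = sp - cp"
  define b where "b = cm - sm"
  have gap: "limit_gap \<phi>\<^sub>c \<phi>\<^sub>s 1 = a" "limit_gap \<phi>\<^sub>c \<phi>\<^sub>s (- 1) = - b"
    using lims by (simp_all add: limit_gap_def a_def b_def tendsto_Lim)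
  have diff_top: "((\<lambda>x. \<phi>\<^sub>c x - \<phi>\<^sub>s x) \<longlongrightarrow> - a) at_top"
    using tendsto_diff[OF lims(1,3)] by (simp add: a_def)
  have diff_bot: "((\<lambda>x. \<phi>\<^sub>c x - \<phi>\<^sub>s x) \<longlongrightarrow> b) at_bot"
    using tendsto_diff[OF lims(2,4)] by (simp add: b_def)
  have "- a \<le> - \<delta>"
    using diff_top
  proof (rule tendsto_upperbound)
    show "\<forall>\<^sub>F x in at_top. \<phi>\<^sub>c x - \<phi>\<^sub>s x \<le> - \<delta>"
      using eventually_gt_at_top[of K] by eventually_elim (use negative_drift_right in force)
  qed simp
  then have a: "a > 0" using negative_drift_constants by linarith
  have "\<delta> \<le> b"
    using diff_bot
  proof (rule tendsto_lowerbound)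
    show "\<forall>\<^sub>F x in at_bot. \<delta> \<le> \<phi>\<^sub>c x - \<phi>\<^sub>s x"
      using eventually_le_at_bot[of "- K - 1"]
    proof eventually_elim
      case (elim x)
      then show ?case using negative_drift_left[of x] by simp
    qed
  qed simp
  then have b: "b > 0" using negative_drift_constants by linarith
  obtain Bc where Bc: "\<And>x. \<bar>\<phi>\<^sub>c x\<bar> \<le> Bc"
    using bounded_if_limits_and_powr_bound[OF lims(1,2) sub_quadratic_growth(1) sub_quadratic_exponent(1)] by blast
  obtain Bs where Bs: "\<And>x. \<bar>\<phi>\<^sub>s x\<bar> \<le> Bs"
    using bounded_if_limits_and_powr_bound[OF lims(3,4) sub_quadratic_growth(2) sub_quadratic_exponent(1)] by blast
  define \<Phi> where "\<Phi> = Bc + Bs"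
  have Bc0: "Bc \<ge> 0" and Bs0: "Bs \<ge> 0" using Bc[of 0] Bs[of 0] by linarith+
  have \<epsilon>_lim: "(\<epsilon> \<longlongrightarrow> 0) at_top"
    using regime
  proof
    assume "filterlim \<tau> at_top at_top"
    then have "((\<lambda>\<eta>. inverse (\<tau> \<eta>)) \<longlongrightarrow> 0) at_top"
      by (rule tendsto_inverse_0_at_top)
    from tendsto_mult[OF vanishing this] have "((\<lambda>\<eta>. \<epsilon> \<eta> * \<tau> \<eta> * inverse (\<tau> \<eta>)) \<longlongrightarrow> 0) at_top"
      by simp
    moreover have "\<forall>\<^sub>F \<eta> in at_top. \<epsilon> \<eta> * \<tau> \<eta> * inverse (\<tau> \<eta>) = \<epsilon> \<eta>"
      using eventually_gt_at_top[of 0] by eventually_elim (use scaling(2) in force)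
    ultimately show ?thesis by (rule Lim_transform_eventually)
  qed
  define w where "w \<eta> = \<epsilon> \<eta> * \<tau> \<eta>" for \<eta>
  define \<psi> where "\<psi> \<eta> x = \<phi>\<^sub>c (x / w \<eta>) - \<phi>\<^sub>s (x / w \<eta>)" for \<eta> x
  define s where "s = \<sigma>\<^sub>c lam_star + \<sigma>\<^sub>s mu_star"
  define rc where "rc \<eta> = controlled_rate (lam_star_at \<eta>) (\<epsilon> \<eta>) (\<tau> \<eta>) \<phi>\<^sub>c lam_max lam_min" for \<eta>
  define rs where "rs \<eta> = controlled_rate mu_star (\<epsilon> \<eta>) (\<tau> \<eta>) \<phi>\<^sub>s mu_max mu_min" for \<eta>
  define V where "V \<eta> z = \<sigma>\<^sub>c (rc \<eta> z) + \<sigma>\<^sub>s (rs \<eta> z) + (rc \<eta> z - rs \<eta> z)\<^sup>2" for \<eta> z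
  have queue: "matching_arrivals (M \<eta>) (a\<^sub>c \<eta>) (a\<^sub>s \<eta>) (rc \<eta>) (rs \<eta>) \<sigma>\<^sub>c \<sigma>\<^sub>s C" if "\<eta> > 0" for \<eta>
    using arrivals[OF that] by (simp add: rc_def rs_def)
  have \<psi>_bound: "\<bar>\<psi> \<eta> x\<bar> \<le> \<Phi>" for \<eta> x
    using Bc[of "x / w \<eta>"] Bs[of "x / w \<eta>"] by (simp add: \<psi>_def \<Phi>_def)
  have w_lim: "(w \<longlongrightarrow> 0) at_top" and w_pos: "\<forall>\<^sub>F \<eta> in at_top. w \<eta> > 0"
    using vanishing eventually_mono[OF eventually_gt_at_top[of "0 :: real"], of "\<lambda>\<eta>. w \<eta> > 0"]
    by (simp_all add: w_def[abs_def] scaling)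
  have \<psi>_right: "\<forall>\<^sub>F \<eta> in at_top. \<forall>x\<ge>r. \<bar>\<psi> \<eta> x + a\<bar> \<le> e" if "r > 0" "e > 0" for r e
    using rescaled_limit_uniform[OF diff_top w_lim w_pos that] by (simp add: \<psi>_def)
  have \<psi>_left: "\<forall>\<^sub>F \<eta> in at_top. \<forall>x\<le>-r. \<bar>\<psi> \<eta> x - b\<bar> \<le> e" if "r > 0" "e > 0" for r e
  proof -
    have "((\<lambda>x. \<phi>\<^sub>c (- x) - \<phi>\<^sub>s (- x)) \<longlongrightarrow> b) at_top"
      using diff_bot by (simp add: filterlim_at_bot_mirror)
    from rescaled_limit_uniform[OF this w_lim w_pos that] show ?thesis
    proof eventually_elim
      case (elim \<eta>)
      show ?case
      proof (intro allI impI)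
        fix x assume "x \<le> - r"
        then have "r \<le> - x" by simp
        with elim have "\<bar>\<phi>\<^sub>c (- (- x / w \<eta>)) - \<phi>\<^sub>s (- (- x / w \<eta>)) - b\<bar> \<le> e" by blast
        then show "\<bar>\<psi> \<eta> x - b\<bar> \<le> e" by (simp add: \<psi>_def)
      qed
    qed
  qed
  \<comment> \<open>For large \<open>\<eta>\<close> clipping has no effect, because both rates are within \<open>\<epsilon> \<eta> * \<Phi>\<close> of the
      interior point \<open>mu_star\<close>.\<close>
  define good where "good \<eta> \<longleftrightarrow> \<eta> > 0 \<and> \<eta> > \<eta>\<^sub>p \<and>
    (\<forall>z. rc \<eta> z = mu_star + \<epsilon> \<eta> * \<phi>\<^sub>c (real_of_int z / \<tau> \<eta>) \<and> rs \<eta> z = mu_star + \<epsilon> \<eta> * \<phi>\<^sub>s (real_of_int z / \<tau> \<eta>))" for \<eta>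
  have good: "\<forall>\<^sub>F \<eta> in at_top. good \<eta>"
  proof -
    define m where "m = min (min (mu_star - lam_min) (lam_max - mu_star)) (min (mu_star - mu_min) (mu_max - mu_star))"
    have "m > 0" using mu_star by (simp add: m_def)
    moreover have "((\<lambda>\<eta>. \<epsilon> \<eta> * \<Phi>) \<longlongrightarrow> 0) at_top"
      using tendsto_mult_left_zero[OF \<epsilon>_lim] .
    ultimately have "\<forall>\<^sub>F \<eta> in at_top. \<epsilon> \<eta> * \<Phi> < m"
      by (intro order_tendstoD)
    with eventually_gt_at_top[of 0] eventually_gt_at_top[of \<eta>\<^sub>p] show ?thesis
    proof eventually_elim
      case (elim \<eta>)
      have small: "\<bar>\<epsilon> \<eta> * \<phi>\<^sub>c x\<bar> < m" "\<bar>\<epsilon> \<eta> * \<phi>\<^sub>s x\<bar> < m" for x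
      proof -
        have "\<bar>\<epsilon> \<eta> * \<phi>\<^sub>c x\<bar> \<le> \<epsilon> \<eta> * \<Phi>" "\<bar>\<epsilon> \<eta> * \<phi>\<^sub>s x\<bar> \<le> \<epsilon> \<eta> * \<Phi>"
          using Bc[of x] Bs[of x] Bc0 Bs0 scaling(1)[OF elim(1)] by (auto simp: abs_mult \<Phi>_def intro!: mult_left_mono)
        then show "\<bar>\<epsilon> \<eta> * \<phi>\<^sub>c x\<bar> < m" "\<bar>\<epsilon> \<eta> * \<phi>\<^sub>s x\<bar> < m" using elim by linarith+
      qed
      have "rc \<eta> z = mu_star + \<epsilon> \<eta> * \<phi>\<^sub>c (real_of_int z / \<tau> \<eta>)" for z
        unfolding rc_def controlled_rate_def balanced(1)[OF elim(1)] balanced(2)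
        using small(1)[of "real_of_int z / \<tau> \<eta>"] by (intro clip_inactive) (auto simp: m_def)
      moreover have "rs \<eta> z = mu_star + \<epsilon> \<eta> * \<phi>\<^sub>s (real_of_int z / \<tau> \<eta>)" for z
        unfolding rs_def controlled_rate_def
        using small(2)[of "real_of_int z / \<tau> \<eta>"] by (intro clip_inactive) (auto simp: m_def)
      ultimately show ?case using elim by (simp add: good_def)
    qed
  qed
  have V_lim: "\<forall>\<^sub>F \<eta> in at_top. \<forall>z. \<bar>V \<eta> z - s\<bar> \<le> d" if "d > 0" for d
  proof -
    have d3: "d / 3 > 0" using that by simp
    have "isCont \<sigma>\<^sub>c mu_star" "isCont \<sigma>\<^sub>s mu_star"
      using \<sigma>\<^sub>c(1) \<sigma>\<^sub>s(1) by (auto simp: continuous_on_eq_continuous_at)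
    then obtain kc ks where kc: "kc > 0" "\<And>x. \<bar>x - mu_star\<bar> < kc \<Longrightarrow> \<bar>\<sigma>\<^sub>c x - \<sigma>\<^sub>c mu_star\<bar> < d / 3"
      and ks: "ks > 0" "\<And>x. \<bar>x - mu_star\<bar> < ks \<Longrightarrow> \<bar>\<sigma>\<^sub>s x - \<sigma>\<^sub>s mu_star\<bar> < d / 3"
      using d3 unfolding continuous_at_eps_delta dist_real_def by metis
    have lim: "((\<lambda>\<eta>. \<epsilon> \<eta> * \<Phi>) \<longlongrightarrow> 0) at_top" "((\<lambda>\<eta>. (\<epsilon> \<eta> * \<Phi>)\<^sup>2) \<longlongrightarrow> 0) at_top"
      using \<epsilon>_lim by (auto intro!: tendsto_eq_intros)
    from good order_tendstoD(2)[OF lim(1) kc(1)] order_tendstoD(2)[OF lim(1) ks(1)] order_tendstoD(2)[OF lim(2) d3]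
    show ?thesis
    proof eventually_elim
      case (elim \<eta>)
      have e: "\<epsilon> \<eta> > 0" using elim scaling(1) by (simp add: good_def)
      show ?case
      proof
        fix z
        let ?x = "real_of_int z / \<tau> \<eta>"
        have le: "\<epsilon> \<eta> * \<bar>\<phi>\<^sub>c ?x\<bar> \<le> \<epsilon> \<eta> * \<Phi>" "\<epsilon> \<eta> * \<bar>\<phi>\<^sub>s ?x\<bar> \<le> \<epsilon> \<eta> * \<Phi>"
            "\<epsilon> \<eta> * \<bar>\<phi>\<^sub>c ?x - \<phi>\<^sub>s ?x\<bar> \<le> \<epsilon> \<eta> * \<Phi>"
          using Bc[of ?x] Bs[of ?x] Bc0 Bs0 e by (auto simp: \<Phi>_def intro!: mult_left_mono)
        have rates: "rc \<eta> z - mu_star = \<epsilon> \<eta> * \<phi>\<^sub>c ?x" "rs \<eta> z - mu_star = \<epsilon> \<eta> * \<phi>\<^sub>s ?x"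
            "rc \<eta> z - rs \<eta> z = \<epsilon> \<eta> * (\<phi>\<^sub>c ?x - \<phi>\<^sub>s ?x)"
          using elim by (auto simp: good_def right_diff_distrib)
        have "\<bar>\<sigma>\<^sub>c (rc \<eta> z) - \<sigma>\<^sub>c mu_star\<bar> < d / 3" "\<bar>\<sigma>\<^sub>s (rs \<eta> z) - \<sigma>\<^sub>s mu_star\<bar> < d / 3"
          using kc(2)[of "rc \<eta> z"] ks(2)[of "rs \<eta> z"] le elim e unfolding rates abs_mult by auto
        moreover have "(rc \<eta> z - rs \<eta> z)\<^sup>2 \<le> (\<epsilon> \<eta> * \<Phi>)\<^sup>2"
          unfolding rates abs_le_square_iff[symmetric] using le(3) e Bc0 Bs0 by (simp add: abs_mult \<Phi>_def)
        moreover have "0 \<le> (rc \<eta> z - rs \<eta> z)\<^sup>2" by simp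
        ultimately show "\<bar>V \<eta> z - s\<bar> \<le> d"
          using elim balanced(2) unfolding V_def s_def by (simp only: abs_le_iff) linarith
      qed
    qed
  qed
  \<comment> \<open>The growth condition forces both curves to vanish at 0, so in state 0 the second moment of the
      jump equals \<open>s\<close> for every \<open>\<eta>\<close>, and the jump condition bounds it from below.\<close>
  have s: "s > 0"
  proof -
    interpret matching_arrivals "M 1" "a\<^sub>c 1" "a\<^sub>s 1" "rc 1" "rs 1" \<sigma>\<^sub>c \<sigma>\<^sub>s C
      by (rule queue) simp
    have "\<phi>\<^sub>c 0 = 0" "\<phi>\<^sub>s 0 = 0"
      using sub_quadratic_growth[of 0] by simp_all
    then have "rc 1 0 = mu_star" "rs 1 0 = mu_star"
      using mu_star balanced(1)[of 1] balanced(2) by (simp_all add: rc_def rs_def controlled_rate_def clip_inactive)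
    then have "jump_square 0 = s"
      using balanced(2) by (simp add: jump_square_def s_def)
    moreover have "p_min \<le> measure (M 1) {\<omega> \<in> space (M 1). a\<^sub>c 1 0 0 \<omega> > a\<^sub>s 1 0 0 \<omega>}"
      using jumps[of 1 0] negative_drift_constants scaling[of 1] by simp
    ultimately show ?thesis using jump_square_ge_prob[of 0] p_min by linarith
  qed
  have sqrt_eqs: "sqrt \<bar>a * - b\<bar> = sqrt (a * b)" "\<bar>a\<bar> / \<bar>- b\<bar> = a / b"
    using a b by (simp_all add: abs_mult)
  show ?thesis
    unfolding weak_conv_along_def gap sqrt_eqs s_def[symmetric]
  proof (intro allI impI tendsto_at_topI_sequentially)
    fix x and Y :: "nat \<Rightarrow> real"
    assume cont: "isCont (cdf (asym_laplace 0 (2 * sqrt (a * b) / s) (sqrt (a / b)))) x"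
      and Y: "filterlim Y at_top sequentially"
    \<comment> \<open>A tail of the sequence, along which every index lies in the regime of \<open>good\<close>.\<close>
    obtain n0 where n0: "\<And>n. n \<ge> n0 \<Longrightarrow> good (Y n)"
      using eventually_compose_filterlim[OF good Y] by (auto simp: eventually_sequentially)
    define y where "y n = Y (n + n0)" for n
    have y: "filterlim y at_top sequentially"
      unfolding y_def using Y by (rule filterlim_compose) (rule filterlim_add_const_nat_at_top)
    have good_y: "good (y n)" for n
      using n0[of "n + n0"] by (simp add: y_def)
    have y_pos: "y n > 0" "y n > \<eta>\<^sub>p" for n
      using good_y[of n] by (auto simp: good_def)
    note along = eventually_compose_filterlim[OF _ y]
    interpret diffusion_limit "\<lambda>n. N (y n)" "\<lambda>n \<omega>. \<epsilon> (y n) * real_of_int (zbar (y n) \<omega>)" "\<lambda>n. \<psi> (y n)" s a b \<Phi>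
    proof (rule diffusion_limit.intro)
      show "(\<lambda>\<omega>. \<epsilon> (y n) * real_of_int (zbar (y n) \<omega>)) \<in> borel_measurable (N (y n))" for n
        by (rule measurable_compose[OF steady_state_var[OF y_pos(2)]]) simp
      show "\<psi> (y n) \<in> borel_measurable borel" for n
        unfolding \<psi>_def using curves by measurable
      show "\<forall>\<^sub>F n in sequentially. \<forall>x\<ge>r. \<bar>\<psi> (y n) x + a\<bar> \<le> e" if "r > 0" "e > 0" for r e
        by (rule along[OF \<psi>_right[OF that]])
      show "\<forall>\<^sub>F n in sequentially. \<forall>x\<le>-r. \<bar>\<psi> (y n) x - b\<bar> \<le> e" if "r > 0" "e > 0" for r e
        by (rule along[OF \<psi>_left[OF that]])
    next
      fix g h :: "real \<Rightarrow> real" and G H L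
      assume g: "\<And>x. (g has_real_derivative h x) (at x)" "\<And>x. \<bar>g x\<bar> \<le> G"
        and h: "\<And>x. \<bar>h x\<bar> \<le> H" "\<And>x y. \<bar>h x - h y\<bar> \<le> L * \<bar>x - y\<bar>"
      let ?F = "\<lambda>n x. \<psi> (y n) x * g x + s / 2 * h x"
      let ?I = "\<lambda>n. \<integral>\<omega>. ?F n (\<epsilon> (y n) * real_of_int (zbar (y n) \<omega>)) \<partial>N (y n)"
      have approx: "\<bar>?I n\<bar> \<le> L * C * \<epsilon> (y n) + d * H / 2" if d: "\<forall>z. \<bar>V (y n) z - s\<bar> \<le> d" for n d
      proof -
        let ?e = "\<epsilon> (y n)"
        interpret matching_arrivals "M (y n)" "a\<^sub>c (y n)" "a\<^sub>s (y n)" "rc (y n)" "rs (y n)" \<sigma>\<^sub>c \<sigma>\<^sub>s C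
          by (rule queue[OF y_pos(1)])
        have e: "?e > 0" "\<tau> (y n) > 0" using scaling y_pos by auto
        have "?I n = (\<integral>z. ?F n (?e * real_of_int z) \<partial>distr (N (y n)) (count_space UNIV) (zbar (y n)))"
          by (rule integral_distr[OF steady_state_var[OF y_pos(2)], symmetric]) simp
        also have "\<bar>\<dots>\<bar> \<le> L * C * ?e + d * H / 2"
        proof (rule stationary_generator_approx[OF steady_state[OF y_pos(2)] e(1) _ \<psi>_bound _ g h])
          show "rc (y n) z - rs (y n) z = ?e * \<psi> (y n) (?e * real_of_int z)" for z
            using good_y[of n] e by (simp add: good_def \<psi>_def w_def right_diff_distrib)
          show "\<bar>jump_square z - s\<bar> \<le> d" for z
            using d by (simp add: jump_square_def V_def)
        qed
        finally show ?thesis .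
      qed
      show "?I \<longlonglongrightarrow> 0"
      proof (rule LIMSEQ_I, goal_cases)
        case (1 e)
        have H: "H \<ge> 0" using h(1)[of 0] by linarith
        define d where "d = e / (H + 1)"
        have d: "d > 0" using 1 H by (simp add: d_def)
        have dH: "d * H / 2 \<le> e / 2" using 1 H by (simp add: d_def field_simps)
        have "(\<lambda>n. L * C * \<epsilon> (y n)) \<longlonglongrightarrow> 0"
          by (rule tendsto_mult_right_zero) (rule filterlim_compose[OF \<epsilon>_lim y])
        then have "\<forall>\<^sub>F n in sequentially. L * C * \<epsilon> (y n) < e / 2"
          by (rule order_tendstoD) (use 1 in simp)
        with along[OF V_lim[OF d]] have "\<forall>\<^sub>F n in sequentially. norm (?I n) < e"
        proof eventually_elim
          case (elim n)
          then show ?case using approx[OF elim(1)] dH unfolding real_norm_def by linarith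
        qed
        then show ?case by (simp add: eventually_sequentially)
      qed
    qed (fact s a b \<psi>_bound steady_state_space[OF y_pos(2)])+
    have "(\<lambda>n. cdf (distr (N (y n)) borel (\<lambda>\<omega>. \<epsilon> (y n) * real_of_int (zbar (y n) \<omega>))) x)
        \<longlonglongrightarrow> cdf (asym_laplace 0 (2 * sqrt (a * b) / s) (sqrt (a / b))) x"
      using weak_limit cont by (simp add: weak_conv_m_def weak_conv_def)
    then show "(\<lambda>n. cdf (distr (N (Y n)) borel (\<lambda>\<omega>. \<epsilon> (Y n) * real_of_int (zbar (Y n) \<omega>))) x)
        \<longlonglongrightarrow> cdf (asym_laplace 0 (2 * sqrt (a * b) / s) (sqrt (a / b))) x"
      unfolding y_def by (rule LIMSEQ_offset)
  qed
qed

end
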